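(* There exists a deterministic online bipartite edge-coloring algorithm (under one-sided node arrivals, with known maximum degree $\Delta$) whose competitive ratio is less than $2$ for bipartite graphs with sufficiently large maximum degree $\Delta=\Omega(\log n)$, and whose competitive ratio is $\frac{e}{e-1}+o(1)$ for $\Delta=\omega(\log n)$.
   Context: Online bipartite edge coloring under one-sided node arrivals: the input is a bipartite graph with $n$ offline nodes known up front and $n$ online nodes $v_1,\dots,v_n$; at time $t$ the node $v_t$ is revealed with all its edges to offline nodes, and the algorithm must immediately and irrevocably color these edges so that no two edges sharing an endpoint get the same color. The maximum degree $\Delta$ is known in advance. A deterministic algorithm is $\alpha$-competitive if on every input of maximum degree $\Delta$ it uses at most $\alpha\Delta$ colors. Asymptotics are as $n\to\infty$. *)

theory Defs
  imports Complex_Main "HOL-Library.Landau_Symbols"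
begin

text \<open>
  An input with \<open>n\<close> offline nodes \<open>0, \<dots>, n - 1\<close> and \<open>n\<close> online nodes is the list of the
  neighbourhoods of the online nodes, in order of arrival. An edge \<open>(u, t)\<close> joins the offline
  node \<open>u\<close> to the online node arriving at (0-based) time \<open>t\<close>.
\<close>

type_synonym arrivals = "nat set list"

definition online_inputs :: "nat \<Rightarrow> arrivals set" where
  "online_inputs n = {Ns. length Ns = n \<and> (\<forall>N\<in>set Ns. N \<subseteq> {..<n})}"

definition edges :: "arrivals \<Rightarrow> (nat \<times> nat) set" where
  "edges Ns = {(u, t). t < length Ns \<and> u \<in> Ns ! t}"

definition offline_degree :: "arrivals \<Rightarrow> nat \<Rightarrow> nat" where
  "offline_degree Ns u = card {t. (u, t) \<in> edges Ns}"

definition online_degree :: "arrivals \<Rightarrow> nat \<Rightarrow> nat" where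
  "online_degree Ns t = card {u. (u, t) \<in> edges Ns}"

text \<open>The inserted \<open>0\<close> only matters for the empty graph (\<open>n = 0\<close>).\<close>

definition max_degree :: "nat \<Rightarrow> arrivals \<Rightarrow> nat" where
  "max_degree n Ns =
     Max (insert 0 (offline_degree Ns ` {..<n} \<union> online_degree Ns ` {..<n}))"

definition proper_edge_coloring :: "(nat \<times> nat) set \<Rightarrow> (nat \<times> nat \<Rightarrow> nat) \<Rightarrow> bool" where
  "proper_edge_coloring E c \<longleftrightarrow>
     (\<forall>e\<in>E. \<forall>f\<in>E. e \<noteq> f \<and> (fst e = fst f \<or> snd e = snd f) \<longrightarrow> c e \<noteq> c f)"

text \<open>
  A deterministic online algorithm knows \<open>n\<close> and \<open>\<Delta>\<close>. When an online node arrives, it sees the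
  neighbourhoods revealed so far (the last one being that of the new node) and assigns a color
  to each offline neighbour of the new node. Its own earlier decisions are determined by the
  earlier neighbourhoods and need not be passed along.
\<close>

type_synonym online_algorithm = "nat \<Rightarrow> nat \<Rightarrow> arrivals \<Rightarrow> nat \<Rightarrow> nat"

definition output_coloring ::
    "online_algorithm \<Rightarrow> nat \<Rightarrow> nat \<Rightarrow> arrivals \<Rightarrow> nat \<times> nat \<Rightarrow> nat" where
  "output_coloring A n \<Delta> Ns = (\<lambda>(u, t). A n \<Delta> (take (Suc t) Ns) u)"

definition online_edge_coloring_algorithm :: "online_algorithm \<Rightarrow> bool" where
  "online_edge_coloring_algorithm A \<longleftrightarrow>
     (\<forall>n \<Delta>. \<forall>Ns\<in>online_inputs n. max_degree n Ns = \<Delta> \<longrightarrow>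
        proper_edge_coloring (edges Ns) (output_coloring A n \<Delta> Ns))"

definition competitive :: "online_algorithm \<Rightarrow> nat \<Rightarrow> nat \<Rightarrow> real \<Rightarrow> bool" where
  "competitive A n \<Delta> \<alpha> \<longleftrightarrow>
     (\<forall>Ns\<in>online_inputs n. max_degree n Ns = \<Delta> \<longrightarrow>
        real (card (output_coloring A n \<Delta> Ns ` edges Ns)) \<le> \<alpha> * real \<Delta>)"

end

theory Submission
  imports Defs "HOL-Library.FuncSet"
begin

text \<open>
  One round colors part of a graph of maximum degree \<open>x\<close> with about \<open>x\<close> colors. Every edge
  \<open>(u, v)\<close> draws a color uniformly from the colors not drawn before at \<open>u\<close>; among the edges at
  \<open>v\<close> that drew the same color one keeps it, and the others stay uncolored. As long as nearly
  all colors have expected load at most about \<open>1\<close> at \<open>v\<close>, an edge loses its color with probability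
  about \<open>1/e\<close>, so the uncolored edges form a graph of maximum degree about \<open>x/e\<close>. Repeating
  this and finishing greedily uses about \<open>x (1 + 1/e + 1/e\<^sup>2 + \<dots>) = x e / (e - 1)\<close> colors.

  Loads stay balanced even against an adaptive adversary: for a fixed set \<open>S\<close> of colors, the
  proportion of \<open>S\<close> among the free colors of \<open>u\<close> is a martingale, and the draws at different
  \<open>u\<close> are independent, which beats the union bound over all \<open>S\<close> and all neighbourhoods of \<open>v\<close> once
  \<open>x\<close> exceeds a large multiple of \<open>ln n\<close>. The exponential moments behind these estimates add up to
  a potential that increases by at most \<open>1 / (4 n)\<close> per arrival on average. A deterministic algorithm
  therefore chooses colors for which the increase is no larger than that.
\<close>

subsection \<open>Averages over finite product sets\<close>

lemma exp_le_quadratic: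
  fixes x :: real
  assumes "\<bar>x\<bar> \<le> 1"
  shows "exp x \<le> 1 + x + x\<^sup>2"
proof (cases "0 \<le> x")
  case True
  then show ?thesis using assms exp_bound[of x] by simp
next
  case False
  define y where "y = - x"
  have y: "0 < y" "y \<le> 1" using False assms by (auto simp: y_def)
  \<comment> \<open>The product equals \<open>1 + y ^ 3\<close>, and its first factor is at most
    \<open>exp y\<close>.\<close>
  have "1 \<le> (1 + y) * (1 - y + y\<^sup>2)"
    using y by (simp add: algebra_simps power2_eq_square)
  also have "\<dots> \<le> exp y * (1 - y + y\<^sup>2)"
    using exp_ge_add_one_self[of y] y by (intro mult_right_mono) (auto simp: add.commute)
  finally have "1 \<le> exp y * (1 - y + y\<^sup>2)" .
  then have "exp (- y) \<le> 1 - y + y\<^sup>2"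
    by (simp add: exp_minus field_simps)
  then show ?thesis by (simp add: y_def)
qed

text \<open>Serves to bound a product of factors \<open>1 - y\<close> from below by the exponential
  of a sum, at the price of a quadratic error.\<close>

lemma exp_le_one_minus:
  fixes y :: real
  assumes "0 \<le> y" "y \<le> 1/2"
  shows "exp (- (y + 2 * y\<^sup>2)) \<le> 1 - y"
proof -
  have "- y - 2 * y\<^sup>2 \<le> ln (1 - y)"
    using ln_one_minus_pos_lower_bound[of y] assms by simp
  then have "exp (- y - 2 * y\<^sup>2) \<le> exp (ln (1 - y))" by simp
  also have "\<dots> = 1 - y" using assms by simp
  finally show ?thesis by (simp add: algebra_simps)
qed

text \<open>The linear term of the quadratic bound on \<open>exp\<close> averages to zero, which
  leaves \<open>1 + M\<^sup>2\<close>.\<close>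

lemma mean_exp_centered:
  fixes z :: "'a \<Rightarrow> real"
  assumes "finite A" "A \<noteq> {}" "\<And>a. a \<in> A \<Longrightarrow> \<bar>z a\<bar> \<le> M" "M \<le> 1" "(\<Sum>a\<in>A. z a) = 0"
  shows "(\<Sum>a\<in>A. exp (z a)) / card A \<le> exp (M\<^sup>2)"
proof -
  have "exp (z a) \<le> 1 + z a + M\<^sup>2" if "a \<in> A" for a
  proof -
    have "\<bar>z a\<bar>\<^sup>2 \<le> M\<^sup>2" using assms(3)[OF that] by (intro power_mono) auto
    then show ?thesis
      using exp_le_quadratic[of "z a"] assms(3)[OF that] assms(4) by simp
  qed
  then have "(\<Sum>a\<in>A. exp (z a)) \<le> (\<Sum>a\<in>A. 1 + z a + M\<^sup>2)" by (intro sum_mono) auto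
  also have "\<dots> = card A * (1 + M\<^sup>2)"
    using assms(5) by (simp add: sum.distrib algebra_simps)
  also have "\<dots> \<le> card A * exp (M\<^sup>2)"
    using exp_ge_add_one_self[of "M\<^sup>2"] by (intro mult_left_mono) auto
  finally show ?thesis
    using assms(1,2) by (simp add: divide_le_eq card_gt_0_iff mult.commute)
qed

text \<open>A form of Hoeffding's lemma: a function of oscillation at most 1 stays within 1 of its
  mean, because the deviation is itself an average of differences. The centered bound then applies
  to \<open>\<eta> * (h a - g)\<close>.\<close>

lemma mean_exp_bounded_oscillation:
  fixes h :: "'a \<Rightarrow> real"
  assumes "finite A" "A \<noteq> {}" "\<And>a b. a \<in> A \<Longrightarrow> b \<in> A \<Longrightarrow> \<bar>h a - h b\<bar> \<le> 1" "0 \<le> \<eta>" "\<eta> \<le> 1"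
  shows "(\<Sum>a\<in>A. exp (\<eta> * h a)) / card A \<le> exp (\<eta> * ((\<Sum>a\<in>A. h a) / card A) + \<eta>\<^sup>2)"
proof -
  define g where "g = (\<Sum>a\<in>A. h a) / card A"
  have A: "real (card A) > 0" using assms(1,2) by (simp add: card_gt_0_iff)
  have dev: "\<bar>\<eta> * (h a - g)\<bar> \<le> \<eta>" if "a \<in> A" for a
  proof -
    have "h a - g = (\<Sum>b\<in>A. h a - h b) / card A"
      using A by (simp add: g_def sum_subtractf field_simps)
    also have "\<bar>\<dots>\<bar> \<le> (\<Sum>b\<in>A. \<bar>h a - h b\<bar>) / card A"
      using A by (simp add: divide_right_mono)
    also have "\<dots> \<le> (\<Sum>b\<in>A. 1) / card A"
      using A assms(3)[OF that] by (intro divide_right_mono sum_mono) auto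
    also have "\<dots> = 1" using A by simp
    finally have "\<bar>h a - g\<bar> \<le> 1" .
    then show ?thesis using assms(4) by (simp add: abs_mult mult_left_le)
  qed
  have "(\<Sum>a\<in>A. \<eta> * (h a - g)) = 0"
    using A by (simp add: sum_distrib_left[symmetric] sum_subtractf g_def)
  then have "(\<Sum>a\<in>A. exp (\<eta> * (h a - g))) / card A \<le> exp (\<eta>\<^sup>2)"
    using dev assms by (intro mean_exp_centered) auto
  then have "exp (\<eta> * g) * ((\<Sum>a\<in>A. exp (\<eta> * (h a - g))) / card A) \<le> exp (\<eta> * g) * exp (\<eta>\<^sup>2)"
    by (intro mult_left_mono) auto
  moreover have "exp (\<eta> * g) * (\<Sum>a\<in>A. exp (\<eta> * (h a - g))) = (\<Sum>a\<in>A. exp (\<eta> * h a))"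
    by (simp add: sum_distrib_left exp_add[symmetric] algebra_simps)
  ultimately show ?thesis by (simp add: exp_add g_def)
qed

text \<open>The expectation when each coordinate \<open>u\<close> is drawn independently and
  uniformly from \<open>F u\<close>, expressed as a finite average.\<close>

definition pi_mean :: "'a set \<Rightarrow> ('a \<Rightarrow> 'b set) \<Rightarrow> (('a \<Rightarrow> 'b) \<Rightarrow> real) \<Rightarrow> real" where
  "pi_mean U F f = (\<Sum>c\<in>Pi\<^sub>E U F. f c) / real (card (Pi\<^sub>E U F))"

lemma pi_mean_mono:
  assumes "\<And>c. c \<in> Pi\<^sub>E U F \<Longrightarrow> f c \<le> g c"
  shows "pi_mean U F f \<le> pi_mean U F g"
  unfolding pi_mean_def by (intro divide_right_mono sum_mono assms) auto

lemma pi_mean_cong: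
  assumes "\<And>c. c \<in> Pi\<^sub>E U F \<Longrightarrow> f c = g c"
  shows "pi_mean U F f = pi_mean U F g"
  unfolding pi_mean_def using assms by (metis (no_types, lifting) sum.cong)

lemma pi_mean_add: "pi_mean U F (\<lambda>c. f c + g c) = pi_mean U F f + pi_mean U F g"
  by (simp add: pi_mean_def sum.distrib add_divide_distrib)

lemma pi_mean_diff: "pi_mean U F (\<lambda>c. f c - g c) = pi_mean U F f - pi_mean U F g"
  by (simp add: pi_mean_def sum_subtractf diff_divide_distrib)

lemma pi_mean_cmult: "pi_mean U F (\<lambda>c. r * f c) = r * pi_mean U F f"
  by (simp add: pi_mean_def sum_distrib_left)

lemma pi_mean_divide: "pi_mean U F (\<lambda>c. f c / r) = pi_mean U F f / r"
  using pi_mean_cmult[of U F "1 / r" f] by simp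

lemma pi_mean_sum: "pi_mean U F (\<lambda>c. \<Sum>i\<in>I. f i c) = (\<Sum>i\<in>I. pi_mean U F (f i))"
  unfolding pi_mean_def by (subst sum.swap) (simp add: sum_divide_distrib)

context
  fixes U :: "'a set" and F :: "'a \<Rightarrow> 'b set"
  assumes fin: "finite U" and F: "\<And>u. u \<in> U \<Longrightarrow> finite (F u) \<and> F u \<noteq> {}"
begin

lemma finite_PiE_U: "finite (Pi\<^sub>E U F)" and card_PiE_U_pos: "card (Pi\<^sub>E U F) > 0"
  using fin F by (auto simp: finite_PiE card_gt_0_iff PiE_eq_empty_iff)

lemma pi_mean_const: "pi_mean U F (\<lambda>_. r) = r"
  using card_PiE_U_pos by (simp add: pi_mean_def)

text \<open>The derandomization principle: what is controlled on average is controlled at some fixed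
  choice of colors.\<close>

lemma pi_mean_attained: "\<exists>c\<in>Pi\<^sub>E U F. f c \<le> pi_mean U F f"
proof (rule ccontr)
  assume "\<not> ?thesis"
  then have "\<And>c. c \<in> Pi\<^sub>E U F \<Longrightarrow> pi_mean U F f < f c" by force
  moreover have "Pi\<^sub>E U F \<noteq> {}" using card_PiE_U_pos by (metis card.empty less_numeral_extra(3))
  ultimately have "(\<Sum>c\<in>Pi\<^sub>E U F. pi_mean U F f) < (\<Sum>c\<in>Pi\<^sub>E U F. f c)"
    by (intro sum_strict_mono finite_PiE_U) auto
  then show False using card_PiE_U_pos by (simp add: pi_mean_def)
qed

text \<open>Independence of the coordinates, in the form of the distributive law for sums over
  \<open>Pi\<^sub>E U F\<close>.\<close>

lemma pi_mean_prod:
  "pi_mean U F (\<lambda>c. \<Prod>u\<in>U. g u (c u)) = (\<Prod>u\<in>U. (\<Sum>a\<in>F u. g u a) / card (F u))"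
  using fin F
  by (simp add: pi_mean_def card_PiE prod_dividef prod_sum_PiE)

end

text \<open>Conditioning on the coordinate \<open>u\<close>; it drives the induction over
  coordinates below.\<close>

lemma pi_mean_insert:
  assumes "finite U" "u \<notin> U" "finite (F u)"
  shows "pi_mean (insert u U) F f = (\<Sum>a\<in>F u. pi_mean U F (\<lambda>c. f (c(u := a)))) / card (F u)"
proof -
  have inj: "inj_on (\<lambda>(y, g). g(u := y)) (F u \<times> Pi\<^sub>E U F)"
    using assms(2) by (rule inj_combinator)
  have "(\<Sum>c\<in>Pi\<^sub>E (insert u U) F. f c) = (\<Sum>a\<in>F u. \<Sum>c\<in>Pi\<^sub>E U F. f (c(u := a)))"
    unfolding PiE_insert_eq sum.reindex[OF inj]
    by (simp add: sum.cartesian_product case_prod_unfold comp_def)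
  moreover have "card (Pi\<^sub>E (insert u U) F) = card (F u) * card (Pi\<^sub>E U F)"
    using assms by (simp add: card_PiE)
  ultimately show ?thesis
    by (simp add: pi_mean_def sum_divide_distrib[symmetric])
qed

text \<open>McDiarmid's inequality in exponential-moment form: averaging out one coordinate at a time
  preserves bounded differences in the remaining coordinates.\<close>

lemma pi_mean_exp_bounded_differences:
  fixes f :: "('a \<Rightarrow> 'b) \<Rightarrow> real"
  assumes "finite U" "\<And>u. u \<in> U \<Longrightarrow> finite (F u) \<and> F u \<noteq> {}"
    and "\<And>c u a b. u \<in> U \<Longrightarrow> \<bar>f (c(u := a)) - f (c(u := b))\<bar> \<le> 1"
    and "0 \<le> \<eta>" "\<eta> \<le> 1"
  shows "pi_mean U F (\<lambda>c. exp (\<eta> * f c)) \<le> exp (\<eta> * pi_mean U F f + \<eta>\<^sup>2 * card U)"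
  using assms(1-3)
proof (induction U arbitrary: f rule: finite_induct)
  case empty
  then show ?case by (simp add: pi_mean_def)
next
  case (insert u U)
  define g where "g = (\<lambda>c. (\<Sum>a\<in>F u. f (c(u := a))) / card (F u))"
  have Fu: "finite (F u)" "F u \<noteq> {}" "real (card (F u)) > 0"
    using insert.prems(1)[of u] by (auto simp: card_gt_0_iff)
  have gdiff: "\<bar>g (c(v := a)) - g (c(v := b))\<bar> \<le> 1" if v: "v \<in> U" for c v a b
  proof -
    have "v \<noteq> u" using insert.hyps v by auto
    then have "g (c(v := a)) - g (c(v := b)) =
        (\<Sum>e\<in>F u. f ((c(u := e))(v := a)) - f ((c(u := e))(v := b))) / card (F u)"
      by (simp add: g_def sum_subtractf diff_divide_distrib fun_upd_twist)
    also have "\<bar>\<dots>\<bar> \<le> (\<Sum>e\<in>F u. \<bar>f ((c(u := e))(v := a)) - f ((c(u := e))(v := b))\<bar>) / card (F u)"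
      using Fu by (simp add: divide_right_mono)
    also have "\<dots> \<le> (\<Sum>e\<in>F u. 1) / card (F u)"
      using v Fu by (intro divide_right_mono sum_mono insert.prems(2)) auto
    finally show ?thesis using Fu by simp
  qed
  have mean_g: "pi_mean U F g = pi_mean (insert u U) F f"
    using insert.hyps Fu unfolding g_def
    by (simp add: pi_mean_insert pi_mean_divide pi_mean_sum)
  have "pi_mean (insert u U) F (\<lambda>c. exp (\<eta> * f c)) =
      pi_mean U F (\<lambda>c. (\<Sum>a\<in>F u. exp (\<eta> * f (c(u := a)))) / card (F u))"
    using insert.hyps Fu by (simp add: pi_mean_insert pi_mean_divide pi_mean_sum)
  also have "\<dots> \<le> pi_mean U F (\<lambda>c. exp (\<eta>\<^sup>2) * exp (\<eta> * g c))"
  proof (rule pi_mean_mono)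
    fix c
    have "(\<Sum>a\<in>F u. exp (\<eta> * f (c(u := a)))) / card (F u) \<le> exp (\<eta> * g c + \<eta>\<^sup>2)"
      unfolding g_def using Fu assms(4,5)
      by (intro mean_exp_bounded_oscillation insert.prems(2)) auto
    then show "(\<Sum>a\<in>F u. exp (\<eta> * f (c(u := a)))) / card (F u) \<le> exp (\<eta>\<^sup>2) * exp (\<eta> * g c)"
      by (simp add: exp_add mult.commute)
  qed
  also have "\<dots> = exp (\<eta>\<^sup>2) * pi_mean U F (\<lambda>c. exp (\<eta> * g c))"
    by (rule pi_mean_cmult)
  also have "\<dots> \<le> exp (\<eta>\<^sup>2) * exp (\<eta> * pi_mean U F g + \<eta>\<^sup>2 * card U)"
    using insert.prems(1) by (intro mult_left_mono insert.IH gdiff) auto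
  also have "\<dots> = exp (\<eta> * pi_mean (insert u U) F f + \<eta>\<^sup>2 * card (insert u U))"
    using insert.hyps by (simp add: mean_g exp_add[symmetric] algebra_simps)
  finally show ?case .
qed

subsection \<open>Conflicts among independently chosen colors\<close>

text \<open>Each color class contributes 1 in total. Hence the loss probabilities under a uniform
  tie-break add up to the exact number of uncolored edges.\<close>

lemma sum_inverse_card_fibre:
  assumes "finite U"
  shows "(\<Sum>u\<in>U. 1 / real (card {v\<in>U. c v = c u})) = real (card (c ` U))"
proof -
  have "(\<Sum>u\<in>U. 1 / real (card {v\<in>U. c v = c u})) =
      (\<Sum>y\<in>c ` U. \<Sum>u\<in>{u\<in>U. c u = y}. 1 / real (card {v\<in>U. c v = c u}))"
    using assms by (rule sum.image_gen)
  also have "\<dots> = (\<Sum>y\<in>c ` U. 1)"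
  proof (rule sum.cong[OF refl])
    fix y assume "y \<in> c ` U"
    then have "card {u\<in>U. c u = y} > 0" using assms by (auto simp: card_gt_0_iff)
    then show "(\<Sum>u\<in>{u\<in>U. c u = y}. 1 / real (card {v\<in>U. c v = c u})) = 1" by simp
  qed
  finally show ?thesis by simp
qed

text \<open>Keeping the heaviest element of each color class loses no more weight than a uniformly
  random tie-break does on average.\<close>

lemma conflict_losers_exist:
  fixes A :: "'a \<Rightarrow> real" and c :: "'a \<Rightarrow> 'b"
  assumes "finite U"
  shows "\<exists>W\<subseteq>U. inj_on c (U - W) \<and> card W + card (c ` U) = card U \<and>
    (\<Sum>u\<in>W. A u) \<le> (\<Sum>u\<in>U. A u * (1 - 1 / real (card {v\<in>U. c v = c u})))"
proof -
  define T where "T = (\<lambda>y. {v\<in>U. c v = y})"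
  have finT: "finite (T y)" for y using assms by (simp add: T_def)
  have "\<exists>w. w \<in> T y \<and> (\<forall>v\<in>T y. A v \<le> A w)" if "y \<in> c ` U" for y
  proof -
    have "T y \<noteq> {}" using that by (auto simp: T_def)
    then have "Max (A ` T y) \<in> A ` T y" using finT by (intro Max_in) auto
    then obtain w where "w \<in> T y" "A w = Max (A ` T y)" by auto
    then show ?thesis using finT by (metis Max_ge finite_imageI imageI)
  qed
  then obtain w where w: "\<And>y. y \<in> c ` U \<Longrightarrow> w y \<in> T y"
      "\<And>y v. y \<in> c ` U \<Longrightarrow> v \<in> T y \<Longrightarrow> A v \<le> A (w y)"
    by metis
  have cw: "c (w y) = y" "w y \<in> U" if "y \<in> c ` U" for y using w(1)[OF that] by (auto simp: T_def)
  have injw: "inj_on w (c ` U)" by (metis cw(1) inj_onI)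
  define Q where "Q = w ` c ` U"
  have Q: "Q \<subseteq> U" "finite Q" using cw(2) assms by (auto simp: Q_def)
  have cardQ: "card Q = card (c ` U)" unfolding Q_def using injw by (rule card_image)
  have "(\<Sum>u\<in>U. A u / real (card {v\<in>U. c v = c u})) =
      (\<Sum>y\<in>c ` U. \<Sum>u\<in>{u\<in>U. c u = y}. A u / real (card {v\<in>U. c v = c u}))"
    using assms by (rule sum.image_gen)
  also have "\<dots> \<le> (\<Sum>y\<in>c ` U. A (w y))"
  proof (rule sum_mono)
    fix y assume y: "y \<in> c ` U"
    have pos: "card (T y) > 0" using w(1)[OF y] finT by (auto simp: card_gt_0_iff)
    have "(\<Sum>u\<in>{u\<in>U. c u = y}. A u / real (card {v\<in>U. c v = c u})) = (\<Sum>u\<in>T y. A u / card (T y))"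
      by (rule sum.cong) (auto simp: T_def)
    also have "\<dots> \<le> (\<Sum>u\<in>T y. A (w y) / card (T y))"
      using w(2)[OF y] by (intro sum_mono divide_right_mono) auto
    also have "\<dots> = A (w y)" using pos by simp
    finally show "(\<Sum>u\<in>{u\<in>U. c u = y}. A u / real (card {v\<in>U. c v = c u})) \<le> A (w y)" .
  qed
  also have "\<dots> = (\<Sum>u\<in>Q. A u)" unfolding Q_def by (simp add: sum.reindex[OF injw])
  finally have le: "(\<Sum>u\<in>U. A u / real (card {v\<in>U. c v = c u})) \<le> (\<Sum>u\<in>Q. A u)" .
  have "(\<Sum>u\<in>U - Q. A u) = (\<Sum>u\<in>U. A u) - (\<Sum>u\<in>Q. A u)"
    using Q assms by (simp add: sum_diff)
  also have "\<dots> \<le> (\<Sum>u\<in>U. A u * (1 - 1 / real (card {v\<in>U. c v = c u})))"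
    using le by (simp add: right_diff_distrib sum_subtractf)
  finally have "(\<Sum>u\<in>U - Q. A u) \<le> (\<Sum>u\<in>U. A u * (1 - 1 / real (card {v\<in>U. c v = c u})))" .
  moreover have "inj_on c (U - (U - Q))"
  proof (rule inj_onI)
    fix a b assume "a \<in> U - (U - Q)" "b \<in> U - (U - Q)" "c a = c b"
    then show "a = b" using cw(1) by (auto simp: Q_def)
  qed
  moreover have "card (U - Q) + card (c ` U) = card U"
    using Q assms cardQ by (metis card_Diff_subset card_mono le_add_diff_inverse2)
  ultimately show ?thesis by (intro exI[of _ "U - Q"]) auto
qed

text \<open>If \<open>N\<close> others share the color of \<open>u\<close>, then \<open>u\<close> keeps it with probability
  \<open>1 / (N + 1)\<close>, the integral of \<open>s ^ N\<close> over \<open>[0, 1]\<close>. The mean of \<open>s ^ N\<close> factorises over the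
  coordinates; comparing derivatives in \<open>s\<close> replaces the integration.\<close>

lemma mean_kept_color_ge:
  fixes U :: "'a set" and F :: "'a \<Rightarrow> 'b set" and L \<xi> :: real
  assumes fin: "finite U" and F: "\<And>v. v \<in> U \<Longrightarrow> finite (F v) \<and> F v \<noteq> {}"
    and u: "u \<in> U" and a: "a \<in> F u"
    and \<xi>: "\<And>v. v \<in> U \<Longrightarrow> 1 / real (card (F v)) \<le> \<xi>" "\<xi> \<le> 1/2"
    and L: "(1 + 2 * \<xi>) * (\<Sum>v\<in>U. if a \<in> F v then 1 / real (card (F v)) else 0) \<le> L" "L > 0"
  shows "(1 - exp (- L)) / L / card (F u)
    \<le> pi_mean U F (\<lambda>c. if c u = a then 1 / real (card {v\<in>U. c v = a}) else 0)"
proof -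
  define N where "N = (\<lambda>c. card {v\<in>U - {u}. c v = a})"
  define x where "x = (\<lambda>v. if a \<in> F v then 1 / real (card (F v)) else 0)"
  \<comment> \<open>\<open>G\<close> is the antiderivative of \<open>G'\<close> that vanishes at 0,
    and \<open>G 1\<close> is the mean to be bounded.\<close>
  define G where "G = (\<lambda>s. pi_mean U F (\<lambda>c. if c u = a then s ^ Suc (N c) / real (Suc (N c)) else 0))"
  define G' where "G' = (\<lambda>s. pi_mean U F (\<lambda>c. if c u = a then s ^ N c else 0))"
  \<comment> \<open>\<open>H\<close> is an antiderivative of the lower bound for
    \<open>G' s\<close>; its increment over the unit interval is the left-hand side of the
    claim.\<close>
  define H where "H = (\<lambda>s. exp (- ((1 - s) * L)) / (L * card (F u)))"
  have Fu: "real (card (F u)) > 0" using F[OF u] by (simp add: card_gt_0_iff)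
  have \<xi>0: "0 \<le> \<xi>" using \<xi>(1)[OF u] by (meson divide_nonneg_nonneg of_nat_0_le_iff order_trans zero_le_one)
  have x: "0 \<le> x v" "x v \<le> \<xi>" if "v \<in> U" for v
    using \<xi>(1)[OF that] \<xi>0 by (auto simp: x_def)
  have dG: "DERIV G s :> G' s" for s
  proof -
    have "DERIV (\<lambda>s. if c u = a then s ^ Suc (N c) / real (Suc (N c)) else 0) s :> (if c u = a then s ^ N c else 0)" for c
    proof (cases "c u = a")
      case True
      then show ?thesis
        using DERIV_cdivide[OF DERIV_pow[of "Suc (N c)" s], of "real (Suc (N c))"]
        by (simp del: of_nat_Suc power_Suc)
    qed simp
    then show ?thesis
      unfolding G_def G'_def pi_mean_def by (intro DERIV_cdivide DERIV_sum) auto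
  qed
  have dH: "DERIV H s :> exp (- ((1 - s) * L)) / card (F u)" for s
    unfolding H_def using L(2) Fu by (auto intro!: derivative_eq_intros simp: field_simps)
  have G'_ge: "exp (- ((1 - s) * L)) / card (F u) \<le> G' s" if s: "0 \<le> s" "s \<le> 1" for s
  proof -
    \<comment> \<open>Writes the indicator of \<open>c u = a\<close> times \<open>s ^ N c\<close> as
      a product of functions of single coordinates, so that independence applies.\<close>
    define g where "g = (\<lambda>v b. if v = u then (if b = a then 1 else 0) else (if b = a then s else 1))"
    have "(if c u = a then s ^ N c else 0) = (\<Prod>v\<in>U. g v (c v))" for c
    proof -
      have "(\<Prod>v\<in>U. g v (c v)) = g u (c u) * (\<Prod>v\<in>U - {u}. g v (c v))"
        using fin u by (rule prod.remove)
      also have "(\<Prod>v\<in>U - {u}. g v (c v)) = (\<Prod>v\<in>U - {u}. if c v = a then s else 1)"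
        by (rule prod.cong) (auto simp: g_def)
      also have "\<dots> = (\<Prod>v\<in>{v\<in>U - {u}. c v = a}. s)"
        by (rule prod.inter_filter[symmetric]) (simp add: fin)
      also have "\<dots> = s ^ N c" by (simp only: N_def prod_constant)
      finally show ?thesis by (simp add: g_def)
    qed
    then have "G' s = (\<Prod>v\<in>U. (\<Sum>b\<in>F v. g v b) / card (F v))"
      unfolding G'_def using pi_mean_prod[OF fin F, where g = g] by simp
    also have "\<dots> = (\<Sum>b\<in>F u. g u b) / card (F u) * (\<Prod>v\<in>U - {u}. (\<Sum>b\<in>F v. g v b) / card (F v))"
      using fin u by (rule prod.remove)
    also have "(\<Sum>b\<in>F u. g u b) = 1"
      using a F[OF u] by (simp add: g_def sum.delta)
    also have "(\<Prod>v\<in>U - {u}. (\<Sum>b\<in>F v. g v b) / card (F v)) = (\<Prod>v\<in>U - {u}. 1 - (1 - s) * x v)"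
    proof (rule prod.cong[OF refl])
      fix v assume v: "v \<in> U - {u}"
      then have Fv: "finite (F v)" "real (card (F v)) > 0" using F[of v] by (auto simp: card_gt_0_iff)
      have "(\<Sum>b\<in>F v. g v b) = (\<Sum>b\<in>F v. 1 - (if b = a then 1 - s else 0))"
        using v by (intro sum.cong) (auto simp: g_def)
      also have "\<dots> = card (F v) - (if a \<in> F v then 1 - s else 0)"
        using Fv by (simp add: sum_subtractf sum.delta)
      finally show "(\<Sum>b\<in>F v. g v b) / card (F v) = 1 - (1 - s) * x v"
        using Fv by (auto simp: x_def diff_divide_distrib)
    qed
    finally have G'_eq: "G' s = 1 / card (F u) * (\<Prod>v\<in>U - {u}. 1 - (1 - s) * x v)" .
    \<comment> \<open>For \<open>0 \<le> y \<le> \<xi>\<close> the quadratic error satisfies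
      \<open>y + 2 * y\<^sup>2 \<le> y * (1 + 2 * \<xi>)\<close>. The factor
      \<open>1 + 2 * \<xi>\<close> in the hypothesis on \<open>L\<close> pays for it.\<close>
    have "exp (- ((1 - s) * L)) \<le> exp (- ((1 - s) * ((1 + 2 * \<xi>) * (\<Sum>v\<in>U - {u}. x v))))"
    proof -
      have "(\<Sum>v\<in>U - {u}. x v) \<le> (\<Sum>v\<in>U. x v)"
        using fin x(1) by (intro sum_mono2) auto
      then have "(1 + 2 * \<xi>) * (\<Sum>v\<in>U - {u}. x v) \<le> (1 + 2 * \<xi>) * (\<Sum>v\<in>U. x v)"
        using \<xi>0 by (intro mult_left_mono) auto
      also have "\<dots> \<le> L" using L(1) by (simp add: x_def)
      finally show ?thesis using s by (simp add: mult_left_mono)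
    qed
    also have "\<dots> = (\<Prod>v\<in>U - {u}. exp (- ((1 - s) * x v * (1 + 2 * \<xi>))))"
      using fin by (simp add: exp_sum[symmetric] sum_distrib_left sum_negf mult_ac)
    also have "\<dots> \<le> (\<Prod>v\<in>U - {u}. 1 - (1 - s) * x v)"
    proof (rule prod_mono, safe)
      fix v assume v: "v \<in> U"
      define y where "y = (1 - s) * x v"
      have "y \<le> 1 * x v" unfolding y_def using x[OF v] s by (intro mult_right_mono) auto
      then have y: "0 \<le> y" "y \<le> \<xi>" using x[OF v] s by (auto simp: y_def)
      have "exp (- (y * (1 + 2 * \<xi>))) \<le> exp (- (y + 2 * y\<^sup>2))"
        using y mult_left_mono[OF y(2), of y] by (simp add: algebra_simps power2_eq_square)
      also have "\<dots> \<le> 1 - y" using y \<xi>(2) by (intro exp_le_one_minus) auto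
      finally show "exp (- ((1 - s) * x v * (1 + 2 * \<xi>))) \<le> 1 - (1 - s) * x v"
        by (simp add: y_def)
    qed simp
    finally show ?thesis using Fu by (simp add: G'_eq divide_right_mono)
  qed
  have "G 0 - H 0 \<le> G 1 - H 1"
  proof (rule DERIV_nonneg_imp_nondecreasing[of 0 1 "\<lambda>s. G s - H s"])
    fix s :: real assume "0 \<le> s" "s \<le> 1"
    then show "\<exists>y. ((\<lambda>s. G s - H s) has_real_derivative y) (at s) \<and> 0 \<le> y"
      using DERIV_diff[OF dG dH, of s] G'_ge[of s] by (intro exI[of _ "G' s - exp (- ((1 - s) * L)) / card (F u)"]) auto
  qed simp
  moreover have "G 0 = 0" by (auto simp: G_def pi_mean_def intro!: sum.neutral)
  moreover have "H 1 - H 0 = (1 - exp (- L)) / L / card (F u)"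
    using L(2) Fu by (simp add: H_def field_simps)
  moreover have "G 1 = pi_mean U F (\<lambda>c. if c u = a then 1 / real (card {v\<in>U. c v = a}) else 0)"
    unfolding G_def
  proof (rule pi_mean_cong)
    fix c
    have "card {v\<in>U. c v = a} = Suc (N c)" if "c u = a"
    proof -
      have "{v\<in>U. c v = a} = insert u {v\<in>U - {u}. c v = a}" using u that by auto
      then show ?thesis using fin by (simp add: N_def)
    qed
    then show "(if c u = a then 1 ^ Suc (N c) / real (Suc (N c)) else 0) =
        (if c u = a then 1 / real (card {v\<in>U. c v = a}) else 0)" by simp
  qed
  ultimately show ?thesis by linarith
qed

text \<open>The probability that \<open>u\<close> keeps its color is the sum over \<open>a\<close>
  of the probabilities of drawing and keeping \<open>a\<close>. Discarding the overloaded colors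
  costs at most a fraction \<open>\<theta>\<close> of \<open>F u\<close>, and each remaining color
  contributes at least \<open>q / card (F u)\<close>.\<close>

lemma mean_loss_le:
  fixes U :: "'a set" and F :: "'a \<Rightarrow> 'b set" and L \<xi> \<theta> :: real
  assumes fin: "finite U" and F: "\<And>v. v \<in> U \<Longrightarrow> finite (F v) \<and> F v \<noteq> {}"
    and u: "u \<in> U"
    and \<xi>: "\<And>v. v \<in> U \<Longrightarrow> 1 / real (card (F v)) \<le> \<xi>" "\<xi> \<le> 1/2"
    and L: "L > 0"
    and few: "real (card {a\<in>F u. (1 + 2 * \<xi>) * (\<Sum>v\<in>U. if a \<in> F v then 1 / real (card (F v)) else 0) > L})
      \<le> \<theta> * card (F u)"
  shows "pi_mean U F (\<lambda>c. 1 - 1 / real (card {v\<in>U. c v = c u})) \<le> 1 - (1 - \<theta>) * ((1 - exp (- L)) / L)"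
proof -
  define q where "q = (1 - exp (- L)) / L"
  define B where "B = {a\<in>F u. (1 + 2 * \<xi>) * (\<Sum>v\<in>U. if a \<in> F v then 1 / real (card (F v)) else 0) > L}"
  define kept where "kept = (\<lambda>a (c :: 'a \<Rightarrow> 'b). if c u = a then 1 / real (card {v\<in>U. c v = a}) else 0)"
  have Fu: "finite (F u)" "real (card (F u)) > 0" using F[OF u] by (auto simp: card_gt_0_iff)
  have q: "q \<ge> 0" using L by (simp add: q_def)
  have B: "B \<subseteq> F u" "finite B" using Fu by (auto simp: B_def)
  have "(1 - \<theta>) * card (F u) \<le> real (card (F u)) - card B"
    using few by (simp add: B_def algebra_simps)
  also have "\<dots> = card (F u - B)"
    using B Fu by (simp add: card_Diff_subset card_mono of_nat_diff)
  finally have "(1 - \<theta>) * card (F u) * (q / card (F u)) \<le> card (F u - B) * (q / card (F u))"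
    using q by (intro mult_right_mono) auto
  then have "(1 - \<theta>) * q \<le> card (F u - B) * (q / card (F u))"
    using Fu by (auto split: if_splits)
  also have "\<dots> = (\<Sum>a\<in>F u - B. q / card (F u))" by simp
  also have "\<dots> \<le> (\<Sum>a\<in>F u - B. pi_mean U F (kept a))"
    unfolding q_def kept_def
    by (intro sum_mono mean_kept_color_ge[OF fin F u _ \<xi>]) (auto simp: B_def L)
  also have "\<dots> \<le> (\<Sum>a\<in>F u. pi_mean U F (kept a))"
    using Fu by (intro sum_mono2) (auto simp: pi_mean_def kept_def intro!: divide_nonneg_nonneg sum_nonneg)
  also have "\<dots> = pi_mean U F (\<lambda>c. \<Sum>a\<in>F u. kept a c)"
    by (rule pi_mean_sum[symmetric])
  also have "\<dots> = pi_mean U F (\<lambda>c. 1 / real (card {v\<in>U. c v = c u}))"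
  proof (rule pi_mean_cong)
    fix c assume "c \<in> Pi\<^sub>E U F"
    then have "c u \<in> F u" using u by auto
    then show "(\<Sum>a\<in>F u. kept a c) = 1 / real (card {v\<in>U. c v = c u})"
      using Fu by (simp add: kept_def sum.delta')
  qed
  finally show ?thesis
    using pi_mean_const[OF fin F, where r = 1] by (simp add: pi_mean_diff q_def)
qed

lemma card_image_update_diff:
  assumes "finite U"
  shows "\<bar>real (card (c(u := a) ` U)) - real (card (c(u := b) ` U))\<bar> \<le> 1"
proof (cases "u \<in> U")
  case True
  have "card (c(u := e) ` U) \<ge> card (c ` (U - {u}))" "card (c(u := e) ` U) \<le> Suc (card (c ` (U - {u})))" for e
  proof -
    have "c(u := e) ` U = insert e (c ` (U - {u}))" using True by auto
    then show "card (c(u := e) ` U) \<ge> card (c ` (U - {u}))" "card (c(u := e) ` U) \<le> Suc (card (c ` (U - {u})))"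
      using assms by (auto simp: card_insert_if)
  qed
  from this[of a] this[of b] show ?thesis by linarith
next
  case False
  then have "c(u := e) ` U = c ` U" for e by auto
  then show ?thesis by simp
qed

subsection \<open>The potential of one round\<close>

text \<open>Here \<open>\<theta>\<close> is the precision, \<open>x\<close> the degree bound,
  \<open>K\<close> the palette size and \<open>s\<close> the size of the monitored color sets. The
  surplus of \<open>\<theta> * x\<close> colors keeps all free sets large, and \<open>s\<close> is
  about a fraction \<open>\<theta>\<close> of that surplus.\<close>

locale coloring_round =
  fixes n K s :: nat and \<theta> x :: real
  assumes n: "1 \<le> n" and \<theta>: "0 < \<theta>" "\<theta> \<le> 1/20"
    and large: "4 * ln (real n) + 24 \<le> \<theta> ^ 8 * x"
    and K: "(1 + \<theta>) * x \<le> real K" "real K \<le> (1 + 2 * \<theta>) * x"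
    and s: "\<theta>\<^sup>2 * x \<le> real s" "real s < \<theta>\<^sup>2 * x + 1"
begin

text \<open>This value maximizes \<open>\<kappa> * \<theta> ^ 4 - \<kappa>\<^sup>2\<close>, the gain
  minus the variance cost in the exponent. The maximum \<open>\<theta> ^ 8 / 4\<close> explains the
  eighth power in \<open>large\<close>.\<close>

definition \<kappa> :: real where "\<kappa> = \<theta> ^ 4 / 2"
text \<open>Scaled so that one draw from at least \<open>\<theta> * x + 1\<close> free colors
  changes \<open>\<mu>\<close> times the proportion of \<open>S\<close> by at most
  \<open>\<kappa>\<close>.\<close>

definition \<mu> :: real where "\<mu> = \<kappa> * (\<theta> * x)"
text \<open>Bound on the probability that an edge loses its color: \<open>1/e\<close> plus slack for
  overloaded colors and for loads slightly above 1.\<close>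

definition p :: real where "p = exp (- 1) + 4 * \<theta>"

text \<open>\<open>s / K\<close> is the proportion of \<open>S\<close> in the full palette, the
  starting value of the martingale. The term \<open>\<kappa>\<^sup>2 * d\<close> offsets the
  second-order growth over \<open>d\<close> draws.\<close>

definition weight :: "nat set \<Rightarrow> nat set \<Rightarrow> nat \<Rightarrow> real" where
  "weight S A d = exp (\<mu> * (card (A \<inter> S) / card A - s / K) - \<kappa>\<^sup>2 * d) / n"

text \<open>For a color set \<open>S\<close>, the product over \<open>u\<close> expands into a sum over all sets \<open>U\<close> of offline
  nodes of the exponential moments of the load that \<open>U\<close> puts on \<open>S\<close>, each with weight
  \<open>n ^ (- card U)\<close>; so \<open>balance\<close> carries out the union bound over all \<open>U\<close> and \<open>S\<close>. The
  argument \<open>F u\<close> is the set of free colors of \<open>u\<close>, and \<open>d u\<close> is its current degree.\<close>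

definition balance :: "(nat \<Rightarrow> nat set) \<Rightarrow> (nat \<Rightarrow> nat) \<Rightarrow> real" where
  "balance F d = (\<Sum>S\<in>{S. S \<subseteq> {..<K} \<and> card S = s}. \<Prod>u<n. 1 + weight S (F u) (d u))"

text \<open>Exponential moment of the number \<open>l\<close> of uncolored edges among the
  \<open>d\<close> edges at an offline node. The subtracted term offsets its growth when each edge
  is lost with probability at most \<open>p\<close>.\<close>

definition penalty :: "nat \<Rightarrow> nat \<Rightarrow> real" where
  "penalty l d = exp (\<theta> * l - (p * \<theta> + \<theta>\<^sup>2) * d)"

text \<open>Each summand is scaled to start at no more than 1/4, while any bad event makes one of
  them reach 1. This leaves room for \<open>n\<close> increments of
  \<open>1 / (4 * n)\<close>.\<close>

definition potential :: "(nat \<Rightarrow> nat set) \<Rightarrow> (nat \<Rightarrow> nat) \<Rightarrow> (nat \<Rightarrow> nat) \<Rightarrow> real" where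
  "potential F l d = balance F d / (12 * 2 ^ K) + (\<Sum>u<n. penalty (l u) (d u)) / (4 * n)"

lemma ln_n_nonneg: "0 \<le> ln (real n)"
  using n by simp

lemma x_pos: "0 < x"
proof -
  have "0 < \<theta> ^ 8 * x" using large ln_n_nonneg by linarith
  then show ?thesis using \<theta> by (simp add: zero_less_mult_iff)
qed

lemma large_powers: "4 * ln (real n) + 24 \<le> \<theta> ^ k * x" if "k \<le> 8"
proof -
  have "\<theta> ^ 8 * x \<le> \<theta> ^ k * x"
    using \<theta> that x_pos by (intro mult_right_mono power_decreasing) auto
  then show ?thesis using large by linarith
qed

lemma x_ge: "24 \<le> x"
  using large_powers[of 0] ln_n_nonneg by simp

lemma p_bounds: "0 \<le> p" "p \<le> 1"
proof -
  have "exp (- 1 :: real) \<le> 1 / 2"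
    using exp_ge_add_one_self[of "1::real"] by (simp add: exp_minus field_simps)
  then show "0 \<le> p" "p \<le> 1" using \<theta> by (auto simp: p_def add_nonneg_nonneg)
qed

lemma balance_nonneg: "0 \<le> balance F d"
  unfolding balance_def by (intro sum_nonneg prod_nonneg) (auto simp: weight_def intro!: add_nonneg_nonneg)

lemma penalty_pos: "0 < penalty l d"
  by (simp add: penalty_def)

text \<open>Otherwise some \<open>S\<close> of exactly \<open>s\<close> overloaded colors receives
  load at least \<open>(1 + \<theta>) * s\<close> from \<open>U\<close>, against at most
  \<open>s\<close> expected from the full palette. The summand of \<open>S\<close> in
  \<open>balance\<close> alone then pushes the potential to 1.\<close>

lemma few_overloaded_colors:
  assumes U: "U \<subseteq> {..<n}" "real (card U) \<le> x" and d: "\<And>u. u \<in> U \<Longrightarrow> real (d u) \<le> x"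
    and F: "\<And>u. u \<in> U \<Longrightarrow> finite (F u)"
    and pot: "potential F l d < 1"
  shows "card {a. a < K \<and> (\<Sum>v\<in>U. if a \<in> F v then 1 / real (card (F v)) else 0) > 1 + \<theta>} < s"
proof (rule ccontr)
  define load where "load = (\<lambda>a. \<Sum>v\<in>U. if a \<in> F v then 1 / real (card (F v)) else 0)"
  assume "\<not> ?thesis"
  then have "s \<le> card {a. a < K \<and> load a > 1 + \<theta>}" by (simp add: load_def)
  then obtain S where S: "S \<subseteq> {a. a < K \<and> load a > 1 + \<theta>}" "card S = s" "finite S"
    by (rule obtain_subset_with_card_n)
  have fin: "finite U" using U(1) finite_subset by blast
  have "(\<Sum>a\<in>S. load a) = (\<Sum>v\<in>U. \<Sum>a\<in>S. if a \<in> F v then 1 / real (card (F v)) else 0)"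
    unfolding load_def by (rule sum.swap)
  also have "\<dots> = (\<Sum>v\<in>U. card (F v \<inter> S) / card (F v))"
  proof (rule sum.cong[OF refl])
    fix v
    have "(\<Sum>a\<in>S. if a \<in> F v then 1 / real (card (F v)) else 0) = (\<Sum>a\<in>S \<inter> F v. 1 / real (card (F v)))"
      using S(3) by (rule sum.inter_restrict[symmetric])
    then show "(\<Sum>a\<in>S. if a \<in> F v then 1 / real (card (F v)) else 0) = card (F v \<inter> S) / card (F v)"
      by (simp add: Int_commute)
  qed
  finally have sum_load: "(\<Sum>a\<in>S. load a) = (\<Sum>v\<in>U. card (F v \<inter> S) / card (F v))" .
  have "(1 + \<theta>) * s = (\<Sum>a\<in>S. 1 + \<theta>)" using S(2) by simp
  also have "\<dots> \<le> (\<Sum>a\<in>S. load a)" using S(1) by (intro sum_mono) auto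
  finally have excess: "(1 + \<theta>) * s \<le> (\<Sum>v\<in>U. card (F v \<inter> S) / card (F v))" by (simp add: sum_load)
  have \<kappa>: "0 < \<kappa>" using \<theta> by (simp add: \<kappa>_def)
  have \<mu>: "0 < \<mu>" using \<kappa> \<theta> x_pos by (simp add: \<mu>_def)
  have "0 < \<theta> * x" using \<theta> x_pos by simp
  then have Kx: "x \<le> K" "0 < real K" using K(1) x_pos by (auto simp: distrib_right)
  have "card U * (s / K) \<le> K * (s / K)"
    using U(2) Kx by (intro mult_right_mono) auto
  then have "card U * (s / K) \<le> s" using Kx by simp
  then have dev: "\<theta> * s \<le> (\<Sum>v\<in>U. card (F v \<inter> S) / card (F v)) - card U * (s / K)"
    using excess by (simp add: algebra_simps)
  have "(\<Sum>v\<in>U. real (d v)) \<le> (\<Sum>v\<in>U. x)" using d by (intro sum_mono) auto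
  also have "\<dots> \<le> x * x" using U(2) x_pos by (simp add: mult_right_mono)
  finally have sum_d: "(\<Sum>v\<in>U. real (d v)) \<le> x * x" .
  have "\<mu> * (\<theta> * s) = \<kappa> * \<theta>\<^sup>2 * x * s" by (simp add: \<mu>_def power2_eq_square)
  also have "\<dots> \<ge> \<kappa> * \<theta>\<^sup>2 * x * (\<theta>\<^sup>2 * x)"
    using s(1) \<kappa> x_pos by (intro mult_left_mono) auto
  finally have gain: "\<kappa> * \<theta>\<^sup>2 * x * (\<theta>\<^sup>2 * x) \<le> \<mu> * (\<theta> * s)" .
  \<comment> \<open>A quarter of \<open>large\<close> reads
    \<open>ln n + 6 \<le> \<theta> ^ 8 * x / 4\<close>. The deduction of \<open>x * ln n\<close>
    pays for the factors \<open>1 / n\<close> of the weights.\<close>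
  have "6 * x \<le> x * (\<theta> ^ 8 * x / 4 - ln n)"
    using large x_pos by (simp add: mult.commute[of x] mult_right_mono)
  also have "\<dots> = \<kappa> * \<theta>\<^sup>2 * x * (\<theta>\<^sup>2 * x) - \<kappa>\<^sup>2 * (x * x) - x * ln n"
    by (simp add: \<kappa>_def power2_eq_square eval_nat_numeral algebra_simps)
  also have "\<dots> \<le> \<mu> * (\<theta> * s) - \<kappa>\<^sup>2 * (\<Sum>v\<in>U. real (d v)) - card U * ln n"
    using gain mult_left_mono[OF sum_d, of "\<kappa>\<^sup>2"] mult_right_mono[OF U(2) ln_n_nonneg] by simp
  also have "\<dots> \<le> \<mu> * ((\<Sum>v\<in>U. card (F v \<inter> S) / card (F v)) - card U * (s / K))
      - \<kappa>\<^sup>2 * (\<Sum>v\<in>U. real (d v)) - card U * ln n"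
    using mult_left_mono[OF dev, of \<mu>] \<mu> by simp
  also have "\<dots> = (\<Sum>v\<in>U. \<mu> * (card (F v \<inter> S) / card (F v) - s / K) - \<kappa>\<^sup>2 * d v - ln n)"
    by (simp add: sum_subtractf sum_distrib_left[symmetric])
  finally have exponent: "6 * x \<le> \<dots>" .
  \<comment> \<open>The exponent \<open>6 * x\<close> outweighs the normalization
    \<open>12 * 2 ^ K\<close>, since \<open>K \<le> 2 * x\<close> and
    \<open>24 \<le> x\<close>.\<close>
  have "12 * 2 ^ K \<le> exp 4 * exp (real K)"
  proof (rule mult_mono)
    have e2: "2 \<le> exp (1::real)" using exp_ge_add_one_self[of "1::real"] by simp
    have "2 ^ 4 \<le> exp (1::real) ^ 4" by (intro power_mono e2) simp
    then show "12 \<le> exp (4::real)" by (simp add: exp_of_nat_mult[symmetric])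
    have "2 ^ K \<le> exp (1::real) ^ K" by (intro power_mono e2) simp
    then show "2 ^ K \<le> exp (real K)" by (simp add: exp_of_nat_mult[symmetric])
  qed auto
  also have "\<dots> = exp (4 + K)" by (simp add: exp_add)
  also have "\<dots> \<le> exp (6 * x)"
  proof -
    have "2 * \<theta> * x \<le> 1 * x" using \<theta> x_pos by (intro mult_right_mono) auto
    then have "K \<le> 2 * x" using K(2) by (simp add: algebra_simps)
    then show ?thesis using x_ge by simp
  qed
  also have "\<dots> \<le> exp (\<Sum>v\<in>U. \<mu> * (card (F v \<inter> S) / card (F v) - s / K) - \<kappa>\<^sup>2 * d v - ln n)"
    using exponent by simp
  also have "\<dots> = (\<Prod>v\<in>U. weight S (F v) (d v))"
    using n fin by (simp add: exp_sum weight_def exp_diff)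
  \<comment> \<open>Adding 1 makes every factor at least 1, so the product may be extended from the
    unknown set \<open>U\<close> to all offline nodes.\<close>
  also have "\<dots> \<le> (\<Prod>v\<in>U. 1 + weight S (F v) (d v))"
    by (intro prod_mono) (auto simp: weight_def)
  also have "\<dots> \<le> (\<Prod>v<n. 1 + weight S (F v) (d v))"
    using U(1) by (intro prod_mono2) (auto simp: weight_def intro!: add_nonneg_nonneg)
  also have "\<dots> \<le> balance F d"
    unfolding balance_def
  proof (rule member_le_sum)
    show "S \<in> {S. S \<subseteq> {..<K} \<and> card S = s}" using S by auto
  qed (auto simp: weight_def intro!: prod_nonneg add_nonneg_nonneg)
  finally have "1 \<le> balance F d / (12 * 2 ^ K)" by simp
  moreover have "0 \<le> (\<Sum>u<n. penalty (l u) (d u)) / (4 * n)"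
    by (intro divide_nonneg_nonneg sum_nonneg) (auto simp: penalty_def)
  ultimately show False using pot unfolding potential_def by linarith
qed

text \<open>A uniform draw leaves the mean proportion of \<open>S\<close> unchanged and moves it by
  at most \<open>1 / (\<theta> * x)\<close>. The exponential moment therefore grows by at most
  \<open>exp (\<kappa>\<^sup>2)\<close>, which the increase of \<open>d\<close> cancels
  exactly.\<close>

lemma mean_weight_le:
  assumes A: "finite A" "real (card A) - 1 \<ge> \<theta> * x"
  shows "(\<Sum>a\<in>A. weight S (A - {a}) (Suc d)) / card A \<le> weight S A d"
proof -
  define m k where "m = real (card A)" and "k = real (card (A \<inter> S))"
  have \<theta>x: "0 < \<theta> * x" using \<theta> x_pos by simp
  have m: "m - 1 \<ge> \<theta> * x" "m > 1" using A \<theta>x by (auto simp: m_def)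
  have k: "0 \<le> k" "k \<le> m" using A by (auto simp: k_def m_def card_mono)
  have ne: "A \<noteq> {}" using m by (auto simp: m_def)
  define i where "i = (\<lambda>a. if a \<in> S then 1 else 0 :: real)"
  have card': "real (card ((A - {a}) \<inter> S)) / card (A - {a}) = (k - i a) / (m - 1)" if "a \<in> A" for a
  proof -
    have "real (card (A - {a})) = m - 1"
      using that A m by (simp add: m_def of_nat_diff)
    moreover have "real (card ((A - {a}) \<inter> S)) = k - i a"
    proof (cases "a \<in> S")
      case True
      then have "(A - {a}) \<inter> S = A \<inter> S - {a}" "a \<in> A \<inter> S" using that by auto
      then have "card (A \<inter> S) = Suc (card ((A - {a}) \<inter> S))"
        using A by (metis card.remove finite_Int)
      then show ?thesis using True by (simp add: k_def i_def)
    next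
      case False
      then have "(A - {a}) \<inter> S = A \<inter> S" by auto
      then show ?thesis using False by (simp add: k_def i_def)
    qed
    ultimately show ?thesis by simp
  qed
  define z where "z = (\<lambda>a. \<mu> * ((k - i a) / (m - 1) - k / m))"
  have "(\<Sum>a\<in>A. i a) = k"
    using A by (simp add: i_def k_def sum.If_cases)
  then have "(\<Sum>a\<in>A. (k - i a) / (m - 1) - k / m) = (m * k - k) / (m - 1) - k"
    using m by (simp add: sum_subtractf sum_divide_distrib[symmetric] m_def)
  also have "\<dots> = 0" using m by (simp add: field_simps)
  finally have z_sum: "(\<Sum>a\<in>A. z a) = 0" by (simp add: z_def sum_distrib_left[symmetric])
  have z_abs: "\<bar>z a\<bar> \<le> \<kappa>" for a
  proof -
    \<comment> \<open>With \<open>i a\<close> equal to 0 or 1 and \<open>0 \<le> k \<le> m\<close>,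
      the numerator is at most \<open>m\<close> in absolute value.\<close>
    have "(k - i a) / (m - 1) - k / m = (k - i a * m) / (m * (m - 1))"
      using m by (simp add: field_simps)
    also have "\<bar>\<dots>\<bar> = \<bar>k - i a * m\<bar> / (m * (m - 1))" using m by (simp add: abs_mult)
    also have "\<dots> \<le> m / (m * (m - 1))"
      using m k by (intro divide_right_mono) (auto simp: i_def)
    also have "\<dots> = 1 / (m - 1)" using m by simp
    also have "\<dots> \<le> 1 / (\<theta> * x)" using m \<theta>x by (intro divide_left_mono) auto
    finally have "\<bar>(k - i a) / (m - 1) - k / m\<bar> \<le> 1 / (\<theta> * x)" .
    moreover have "0 \<le> \<mu>" using \<theta> x_pos by (simp add: \<mu>_def \<kappa>_def)
    ultimately have "\<bar>z a\<bar> \<le> \<mu> * (1 / (\<theta> * x))"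
      unfolding z_def by (simp only: abs_mult abs_of_nonneg mult_left_mono)
    then show ?thesis using \<theta>x \<theta> x_pos by (simp add: \<mu>_def)
  qed
  have "\<theta> ^ 4 \<le> 1" using \<theta> by (intro power_le_one) auto
  then have "\<kappa> \<le> 1" by (simp add: \<kappa>_def)
  then have mean: "(\<Sum>a\<in>A. exp (z a)) / card A \<le> exp (\<kappa>\<^sup>2)"
    using A ne z_abs z_sum by (intro mean_exp_centered) auto
  have "weight S (A - {a}) (Suc d) = weight S A d * exp (- \<kappa>\<^sup>2) * exp (z a)" if "a \<in> A" for a
    unfolding weight_def card'[OF that] z_def k_def[symmetric] m_def[symmetric]
    by (simp add: exp_add[symmetric] algebra_simps)
  then have "(\<Sum>a\<in>A. weight S (A - {a}) (Suc d)) / card A =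
      weight S A d * exp (- \<kappa>\<^sup>2) * ((\<Sum>a\<in>A. exp (z a)) / card A)"
    by (simp add: sum_distrib_left)
  also have "\<dots> \<le> weight S A d * exp (- \<kappa>\<^sup>2) * exp (\<kappa>\<^sup>2)"
    using mean by (intro mult_left_mono) (auto simp: weight_def)
  also have "\<dots> = weight S A d" by (simp add: exp_minus)
  finally show ?thesis .
qed

text \<open>For each \<open>S\<close> the mean of the product factorizes by independence, and no
  factor increases on average.\<close>

lemma mean_balance_le:
  assumes U: "U \<subseteq> {..<n}" and F: "\<And>u. u \<in> U \<Longrightarrow> finite (F u) \<and> real (card (F u)) - 1 \<ge> \<theta> * x"
  shows "pi_mean U F (\<lambda>c. balance (\<lambda>u. if u \<in> U then F u - {c u} else F u)
      (\<lambda>u. if u \<in> U then Suc (d u) else d u)) \<le> balance F d"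
proof -
  have fin: "finite U" using U finite_subset by blast
  have F': "finite (F u) \<and> F u \<noteq> {}" if "u \<in> U" for u
    using F[OF that] mult_pos_pos[OF \<theta>(1) x_pos] by auto
  have split: "(\<Prod>u<n. f u) = (\<Prod>u\<in>{..<n} - U. f u) * (\<Prod>u\<in>U. f u)" for f :: "nat \<Rightarrow> real"
    using U by (simp add: prod.subset_diff)
  have "pi_mean U F (\<lambda>c. \<Prod>u<n. 1 + weight S (if u \<in> U then F u - {c u} else F u) (if u \<in> U then Suc (d u) else d u))
      \<le> (\<Prod>u<n. 1 + weight S (F u) (d u))" for S
  proof -
    have "(\<Prod>u<n. 1 + weight S (if u \<in> U then F u - {c u} else F u) (if u \<in> U then Suc (d u) else d u)) =
        (\<Prod>u\<in>{..<n} - U. 1 + weight S (F u) (d u)) * (\<Prod>u\<in>U. 1 + weight S (F u - {c u}) (Suc (d u)))" for c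
      unfolding split by (intro arg_cong2[of _ _ _ _ "(*)"] prod.cong) auto
    then have "pi_mean U F (\<lambda>c. \<Prod>u<n. 1 + weight S (if u \<in> U then F u - {c u} else F u) (if u \<in> U then Suc (d u) else d u)) =
        (\<Prod>u\<in>{..<n} - U. 1 + weight S (F u) (d u)) * (\<Prod>u\<in>U. (\<Sum>a\<in>F u. 1 + weight S (F u - {a}) (Suc (d u))) / card (F u))"
      using pi_mean_prod[OF fin F', where g = "\<lambda>u a. 1 + weight S (F u - {a}) (Suc (d u))"]
      by (simp add: pi_mean_cmult)
    also have "\<dots> \<le> (\<Prod>u\<in>{..<n} - U. 1 + weight S (F u) (d u)) * (\<Prod>u\<in>U. 1 + weight S (F u) (d u))"
    proof (intro mult_left_mono prod_mono conjI)
      fix u assume u: "u \<in> U"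
      have "real (card (F u)) > 0" using F'[OF u] by (simp add: card_gt_0_iff)
      then have "(\<Sum>a\<in>F u. 1 + weight S (F u - {a}) (Suc (d u))) / card (F u) =
          1 + (\<Sum>a\<in>F u. weight S (F u - {a}) (Suc (d u))) / card (F u)"
        by (simp add: sum.distrib add_divide_distrib)
      also have "\<dots> \<le> 1 + weight S (F u) (d u)"
        using F[OF u] mean_weight_le by simp
      finally show "(\<Sum>a\<in>F u. 1 + weight S (F u - {a}) (Suc (d u))) / card (F u) \<le> 1 + weight S (F u) (d u)" .
    qed (auto simp: weight_def intro!: prod_nonneg add_nonneg_nonneg divide_nonneg_nonneg sum_nonneg)
    also have "\<dots> = (\<Prod>u<n. 1 + weight S (F u) (d u))" by (rule split[symmetric])
    finally show ?thesis .
  qed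
  then show ?thesis unfolding balance_def pi_mean_sum by (intro sum_mono)
qed

lemma free_colors_many:
  assumes "card A = K - d" "real (Suc d) \<le> x"
  shows "\<theta> * x \<le> real (card A) - 1"
proof -
  have "0 < \<theta> * x" using \<theta> x_pos by simp
  then have "real d \<le> K" using assms(2) K(1) by (simp add: distrib_right)
  then show ?thesis using assms K(1) by (simp add: of_nat_diff algebra_simps)
qed

text \<open>At most a fraction \<open>\<theta>\<close> of \<open>F u\<close> is overloaded, and
  \<open>L\<close> is at most \<open>1 + 2 * \<theta>\<close>. The keeping probability is thus at
  least about \<open>(1 - 1/e) * (1 - 3 * \<theta>)\<close>.\<close>

lemma mean_loss_le_p:
  assumes U: "U \<subseteq> {..<n}" "real (card U) \<le> x" and u: "u \<in> U"
    and d: "\<And>v. v \<in> U \<Longrightarrow> real (Suc (d v)) \<le> x"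
    and F: "\<And>v. v \<in> U \<Longrightarrow> F v \<subseteq> {..<K}" "\<And>v. v \<in> U \<Longrightarrow> card (F v) = K - d v"
    and pot: "potential F l d < 1"
  shows "pi_mean U F (\<lambda>c. 1 - 1 / real (card {v\<in>U. c v = c u})) \<le> p"
proof -
  define \<xi> where "\<xi> = 1 / (\<theta> * x)"
  define L where "L = (1 + 2 * \<xi>) * (1 + \<theta>)"
  have \<theta>x: "0 < \<theta> * x" using \<theta> x_pos by simp
  have fin: "finite U" using U(1) finite_subset by blast
  have finF: "finite (F v)" if "v \<in> U" for v using F(1)[OF that] finite_subset by blast
  have many: "\<theta> * x \<le> real (card (F v)) - 1" if "v \<in> U" for v
    using free_colors_many F(2)[OF that] d[OF that] by blast
  have F': "finite (F v) \<and> F v \<noteq> {}" if "v \<in> U" for v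
    using finF[OF that] many[OF that] \<theta>x by auto
  have \<xi>1: "1 / real (card (F v)) \<le> \<xi>" if "v \<in> U" for v
    unfolding \<xi>_def using many[OF that] \<theta>x by (intro divide_left_mono) auto
  have "24 \<le> \<theta>\<^sup>2 * x" using large_powers[of 2] ln_n_nonneg by simp
  then have \<xi>\<theta>: "24 * \<xi> \<le> \<theta>"
    unfolding \<xi>_def using \<theta>x by (simp add: divide_le_eq power2_eq_square mult.assoc)
  have \<xi>0: "0 \<le> \<xi>" using \<theta>x by (simp add: \<xi>_def)
  have L1: "1 \<le> L" unfolding L_def using mult_mono[of 1 "1 + 2 * \<xi>" 1 "1 + \<theta>"] \<xi>0 \<theta> by simp
  have L2: "L \<le> 1 + 2 * \<theta>"
  proof -
    have "2 * \<xi> * (1 + \<theta>) \<le> 2 * \<xi> * 2" using \<xi>0 \<theta> by (intro mult_left_mono) auto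
    then show ?thesis using \<xi>\<theta> \<xi>0 by (simp add: L_def distrib_right)
  qed
  have "card {a. a < K \<and> (\<Sum>v\<in>U. if a \<in> F v then 1 / real (card (F v)) else 0) > 1 + \<theta>} < s"
    using U finF pot by (intro few_overloaded_colors[where d = d and l = l]) (auto dest: d)
  moreover have "card {a\<in>F u. (1 + 2 * \<xi>) * (\<Sum>v\<in>U. if a \<in> F v then 1 / real (card (F v)) else 0) > L}
      \<le> card {a. a < K \<and> (\<Sum>v\<in>U. if a \<in> F v then 1 / real (card (F v)) else 0) > 1 + \<theta>}"
    using F(1)[OF u] \<xi>0 by (intro card_mono) (auto simp: L_def)
  \<comment> \<open>The strict inequality below \<open>s\<close> provides the 1 that absorbs the
    rounding up of \<open>s\<close>.\<close>
  ultimately have "real (card {a\<in>F u. (1 + 2 * \<xi>) * (\<Sum>v\<in>U. if a \<in> F v then 1 / real (card (F v)) else 0) > L}) + 1 \<le> s"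
    by linarith
  also have "\<dots> \<le> \<theta> * (\<theta> * x) + 1" using s(2) by (simp add: power2_eq_square mult.assoc)
  also have "\<dots> \<le> \<theta> * card (F u) + 1" using many[OF u] \<theta> by (simp add: mult_left_mono)
  finally have "pi_mean U F (\<lambda>c. 1 - 1 / real (card {v\<in>U. c v = c u})) \<le> 1 - (1 - \<theta>) * ((1 - exp (- L)) / L)"
    using L1 \<xi>\<theta> \<theta> by (intro mean_loss_le[OF fin F' u \<xi>1]) auto
  also have "\<dots> \<le> p"
  proof -
    define e where "e = exp (- 1 :: real)"
    have e: "0 \<le> e" "e \<le> 1" by (auto simp: e_def)
    have "(1 - e) * (1 - 2 * \<theta>) \<le> (1 - e) / L"
    proof -
      have "(1 - 2 * \<theta>) * L \<le> (1 - 2 * \<theta>) * (1 + 2 * \<theta>)" using L2 \<theta> by (intro mult_left_mono) auto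
      also have "\<dots> \<le> 1" by (simp add: algebra_simps)
      finally have "(1 - e) * ((1 - 2 * \<theta>) * L) \<le> (1 - e) * 1" using e by (intro mult_left_mono) auto
      then show ?thesis using L1 by (simp add: le_divide_eq mult.assoc)
    qed
    also have "\<dots> \<le> (1 - exp (- L)) / L" using L1 by (intro divide_right_mono) (auto simp: e_def)
    finally have "(1 - \<theta>) * ((1 - e) * (1 - 2 * \<theta>)) \<le> (1 - \<theta>) * ((1 - exp (- L)) / L)"
      using \<theta> by (intro mult_left_mono) auto
    moreover have "(1 - \<theta>) * ((1 - e) * (1 - 2 * \<theta>)) \<ge> 1 - e - 3 * \<theta>"
    proof -
      have "(1 - e) * ((1 - \<theta>) * (1 - 2 * \<theta>)) \<ge> (1 - e) * (1 - 3 * \<theta>)"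
        using e by (intro mult_left_mono) (auto simp: algebra_simps)
      moreover have "(1 - e) * (1 - 3 * \<theta>) \<ge> 1 - e - 3 * \<theta>"
        using e \<theta> by (simp add: algebra_simps)
      ultimately show ?thesis by (simp add: mult_ac)
    qed
    ultimately show ?thesis using \<theta> by (simp add: p_def e_def)
  qed
  finally show ?thesis .
qed

text \<open>Converts the lower bound on \<open>x\<close> into the failure probability that one
  arrival may add to the potential.\<close>

lemma small_tail: "exp (- (\<theta>\<^sup>2 * x)) \<le> 1 / (4 * n)"
proof -
  have "exp (- (\<theta>\<^sup>2 * x)) \<le> exp (- (2 + ln n))"
    using large_powers[of 2] ln_n_nonneg by simp
  also have "\<dots> = exp (- 2) / n" using n by (simp add: exp_diff exp_minus[symmetric] minus_add_distrib)
  also have "\<dots> \<le> (1 / 4) / n"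
  proof (rule divide_right_mono)
    have "2 ^ 2 \<le> exp (1::real) ^ 2" using exp_ge_add_one_self[of "1::real"] by (intro power_mono) auto
    then show "exp (- 2) \<le> (1 / 4 :: real)" by (simp add: exp_of_nat_mult[symmetric] exp_minus field_simps)
  qed simp
  finally show ?thesis by simp
qed

text \<open>One arrival: the colors are drawn independently and uniformly from the sets of free colors,
  and the average of the new potential exceeds the old one by at most \<open>1 / (4 * n)\<close>.\<close>

lemma round_step:
  assumes U: "U \<subseteq> {..<n}" "real (card U) \<le> x"
    and d: "\<And>v. v \<in> U \<Longrightarrow> real (Suc (d v)) \<le> x"
    and F: "\<And>v. v \<in> U \<Longrightarrow> F v \<subseteq> {..<K}" "\<And>v. v \<in> U \<Longrightarrow> card (F v) = K - d v"
    and pot: "potential F l d + 1 / (4 * n) < 1"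
  shows "\<exists>c W. (\<forall>u\<in>U. c u \<in> F u) \<and> W \<subseteq> U \<and> inj_on c (U - W) \<and>
    real (card W) \<le> (p + 2 * \<theta>) * x \<and>
    potential (\<lambda>u. if u \<in> U then F u - {c u} else F u) (\<lambda>u. if u \<in> W then Suc (l u) else l u)
      (\<lambda>u. if u \<in> U then Suc (d u) else d u) \<le> potential F l d + 1 / (4 * n)"
proof -
  have \<theta>x: "0 < \<theta> * x" using \<theta> x_pos by simp
  have fin: "finite U" using U(1) finite_subset by blast
  have many: "finite (F v) \<and> \<theta> * x \<le> real (card (F v)) - 1" if "v \<in> U" for v
    using free_colors_many F(2)[OF that] d[OF that] F(1)[OF that] finite_subset by blast
  have F': "finite (F v) \<and> F v \<noteq> {}" if "v \<in> U" for v
    using many[OF that] \<theta>x by auto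
  have pot1: "potential F l d < 1" using pot by (smt (verit) divide_nonneg_nonneg of_nat_0_le_iff)
  \<comment> \<open>Given the draws \<open>c\<close>, this is the probability that \<open>u\<close>
    loses its color under a uniform tie-break.\<close>
  define nu where "nu = (\<lambda>(c :: nat \<Rightarrow> nat) u. 1 - 1 / real (card {v\<in>U. c v = c u}))"
  have nu_p: "pi_mean U F (\<lambda>c. nu c u) \<le> p" if "u \<in> U" for u
    unfolding nu_def using mean_loss_le_p[OF U that d F pot1] .
  define A where "A = (\<lambda>u. penalty (l u) (d u))"
  define q where "q = exp (- (p * \<theta> + \<theta>\<^sup>2))"
  have A: "0 < A u" for u by (simp add: A_def penalty_pos)
  define X where "X = (\<lambda>(c :: nat \<Rightarrow> nat). real (card U) - card (c ` U))"
  have X_eq: "X c = (\<Sum>u\<in>U. nu c u)" for c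
    using sum_inverse_card_fibre[OF fin, of c] by (simp add: X_def nu_def sum_subtractf)
  define Bal where "Bal = (\<lambda>c. balance (\<lambda>u. if u \<in> U then F u - {c u} else F u)
      (\<lambda>u. if u \<in> U then Suc (d u) else d u))"
  \<comment> \<open>The mean of the new penalties on \<open>U\<close> under a uniform tie-break,
    given \<open>c\<close>: one more edge multiplies a penalty by \<open>q\<close>, and losing it by
    a further \<open>exp \<theta>\<close>.\<close>
  define Psi where "Psi = (\<lambda>c. \<Sum>u\<in>U. q * A u * (1 + (exp \<theta> - 1) * nu c u))"
  define R where "R = (\<Sum>u\<in>{..<n} - U. A u)"
  define Tail where "Tail = (\<lambda>c. exp (\<theta> * (X c - (p + 2 * \<theta>) * x)))"
  \<comment> \<open>A single sum covers balance, penalties and the number of uncolored edges at the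
    arrival, so that one \<open>c\<close> below the mean serves all three.\<close>
  define T where "T = (\<lambda>c. Bal c / (12 * 2 ^ K) + (R + Psi c) / (4 * n) + Tail c)"
  have Bal: "pi_mean U F Bal \<le> balance F d"
    unfolding Bal_def using many by (intro mean_balance_le U)
  have Psi: "pi_mean U F Psi \<le> (\<Sum>u\<in>U. A u)"
  proof -
    have "pi_mean U F Psi = (\<Sum>u\<in>U. q * A u * (1 + (exp \<theta> - 1) * pi_mean U F (\<lambda>c. nu c u)))"
      unfolding Psi_def pi_mean_sum
      by (simp add: pi_mean_cmult pi_mean_add pi_mean_const[OF fin F'])
    also have "\<dots> \<le> (\<Sum>u\<in>U. A u)"
    proof (rule sum_mono)
      fix u assume u: "u \<in> U"
      have "1 + (exp \<theta> - 1) * pi_mean U F (\<lambda>c. nu c u) \<le> 1 + (exp \<theta> - 1) * p"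
        using nu_p[OF u] \<theta> by (simp add: mult_left_mono)
      also have "\<dots> \<le> 1 + (\<theta> + \<theta>\<^sup>2) * p"
        using exp_bound[of \<theta>] \<theta> p_bounds by (simp add: mult_right_mono)
      also have "\<dots> \<le> 1 + (p * \<theta> + \<theta>\<^sup>2)"
        using p_bounds mult_left_mono[of p 1 "\<theta>\<^sup>2"] by (simp add: algebra_simps)
      also have "\<dots> \<le> exp (p * \<theta> + \<theta>\<^sup>2)" by (rule exp_ge_add_one_self)
      finally have "q * A u * (1 + (exp \<theta> - 1) * pi_mean U F (\<lambda>c. nu c u)) \<le> q * A u * exp (p * \<theta> + \<theta>\<^sup>2)"
        using A[of u] by (intro mult_left_mono) (auto simp: q_def)
      also have "\<dots> = A u * (q * exp (p * \<theta> + \<theta>\<^sup>2))" by simp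
      also have "q * exp (p * \<theta> + \<theta>\<^sup>2) = 1" by (simp add: q_def exp_add[symmetric])
      also have "A u * 1 = A u" by simp
      finally show "q * A u * (1 + (exp \<theta> - 1) * pi_mean U F (\<lambda>c. nu c u)) \<le> A u" .
    qed
    finally show ?thesis .
  qed
  have Tail: "pi_mean U F Tail \<le> 1 / (4 * n)"
  proof -
    have "pi_mean U F X = (\<Sum>u\<in>U. pi_mean U F (\<lambda>c. nu c u))"
      unfolding X_eq[abs_def] by (rule pi_mean_sum)
    also have "\<dots> \<le> (\<Sum>u\<in>U. p)" using nu_p by (rule sum_mono)
    also have "\<dots> \<le> x * p" using U(2) p_bounds by (simp add: mult_right_mono)
    finally have mean_X: "pi_mean U F X \<le> x * p" .
    have "pi_mean U F Tail = exp (- (\<theta> * ((p + 2 * \<theta>) * x))) * pi_mean U F (\<lambda>c. exp (\<theta> * X c))"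
      unfolding Tail_def pi_mean_cmult[symmetric] by (simp add: exp_add[symmetric] right_diff_distrib)
    \<comment> \<open>The resulting exponent \<open>\<theta> * p * x + \<theta>\<^sup>2 * x\<close>,
      compared with the threshold \<open>(p + 2 * \<theta>) * x\<close> in \<open>Tail\<close>,
      leaves \<open>- (\<theta>\<^sup>2 * x)\<close>.\<close>
    also have "pi_mean U F (\<lambda>c. exp (\<theta> * X c)) \<le> exp (\<theta> * pi_mean U F X + \<theta>\<^sup>2 * card U)"
    proof (rule pi_mean_exp_bounded_differences[OF fin F'])
      fix c u a b
      show "\<bar>X (c(u := a)) - X (c(u := b))\<bar> \<le> 1"
        using card_image_update_diff[OF fin, of c u a b] unfolding X_def by linarith
    qed (use \<theta> in auto)
    also have "\<dots> \<le> exp (\<theta> * (x * p) + \<theta>\<^sup>2 * x)"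
      using mean_X U(2) \<theta> by (auto intro!: add_mono mult_left_mono)
    finally have "pi_mean U F Tail \<le> exp (- (\<theta> * ((p + 2 * \<theta>) * x))) * exp (\<theta> * (x * p) + \<theta>\<^sup>2 * x)"
      by (simp add: mult_left_mono)
    also have "\<dots> = exp (- (\<theta>\<^sup>2 * x))" by (simp add: exp_add[symmetric] algebra_simps power2_eq_square)
    also have "\<dots> \<le> 1 / (4 * n)" by (rule small_tail)
    finally show ?thesis .
  qed
  have A_split: "(\<Sum>u<n. A u) = R + (\<Sum>u\<in>U. A u)"
    unfolding R_def using U(1) by (simp add: sum.subset_diff)
  have "pi_mean U F T = pi_mean U F Bal / (12 * 2 ^ K) + (R + pi_mean U F Psi) / (4 * n) + pi_mean U F Tail"
    unfolding T_def by (simp add: pi_mean_add pi_mean_divide pi_mean_const[OF fin F'])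
  also have "\<dots> \<le> balance F d / (12 * 2 ^ K) + (R + (\<Sum>u\<in>U. A u)) / (4 * n) + 1 / (4 * n)"
    using Bal Psi Tail by (intro add_mono divide_right_mono) auto
  also have "\<dots> = potential F l d + 1 / (4 * n)"
    unfolding potential_def A_split[symmetric] by (simp add: A_def)
  finally have "pi_mean U F T \<le> potential F l d + 1 / (4 * n)" .
  moreover obtain c where c: "c \<in> Pi\<^sub>E U F" "T c \<le> pi_mean U F T"
    using pi_mean_attained[where U = U and F = F and f = T, OF fin F'] by blast
  ultimately have Tc: "T c \<le> potential F l d + 1 / (4 * n)" by linarith
  \<comment> \<open>With current penalties as weights, the deterministic tie-break costs no more
    than the random one accounted for in \<open>Psi\<close>.\<close>
  obtain W where W: "W \<subseteq> U" "inj_on c (U - W)" "card W + card (c ` U) = card U"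
      "(\<Sum>u\<in>W. A u) \<le> (\<Sum>u\<in>U. A u * nu c u)"
    unfolding nu_def using conflict_losers_exist[OF fin, of c A] by blast
  have W_X: "real (card W) = X c" using W(3) by (simp add: X_def)
  have Bal0: "0 \<le> Bal c" unfolding Bal_def by (rule balance_nonneg)
  define l' where "l' = (\<lambda>u. if u \<in> W then Suc (l u) else l u)"
  define d' where "d' = (\<lambda>u. if u \<in> U then Suc (d u) else d u)"
  have pen': "(\<Sum>u<n. penalty (l' u) (d' u)) \<le> R + Psi c"
  proof -
    have "(\<Sum>u<n. penalty (l' u) (d' u)) =
        (\<Sum>u\<in>{..<n} - U. penalty (l' u) (d' u)) + (\<Sum>u\<in>U. penalty (l' u) (d' u))"
      using U(1) by (simp add: sum.subset_diff)
    also have "(\<Sum>u\<in>{..<n} - U. penalty (l' u) (d' u)) = R"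
      unfolding R_def using W(1) by (intro sum.cong) (auto simp: l'_def d'_def A_def)
    also have "(\<Sum>u\<in>U. penalty (l' u) (d' u)) = (\<Sum>u\<in>U. q * A u + (if u \<in> W then q * (exp \<theta> - 1) * A u else 0))"
    proof (rule sum.cong[OF refl])
      fix u assume "u \<in> U"
      then have "penalty (l' u) (d' u) = (if u \<in> W then q * exp \<theta> * A u else q * A u)"
        by (simp add: l'_def d'_def A_def q_def penalty_def exp_add[symmetric] algebra_simps)
      then show "penalty (l' u) (d' u) = q * A u + (if u \<in> W then q * (exp \<theta> - 1) * A u else 0)"
        by (simp add: algebra_simps)
    qed
    also have "\<dots> = (\<Sum>u\<in>U. q * A u) + q * (exp \<theta> - 1) * (\<Sum>u\<in>W. A u)"
      using W(1) fin
      by (simp add: sum.distrib sum.inter_restrict[symmetric] Int_absorb1 sum_distrib_left)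
    also have "\<dots> \<le> (\<Sum>u\<in>U. q * A u) + q * (exp \<theta> - 1) * (\<Sum>u\<in>U. A u * nu c u)"
      using W(4) \<theta> by (intro add_left_mono mult_left_mono) (auto simp: q_def)
    also have "\<dots> = Psi c"
      unfolding Psi_def by (simp add: sum_distrib_left sum.distrib[symmetric] algebra_simps)
    finally show ?thesis by simp
  qed
  have R0: "0 \<le> R" unfolding R_def using A by (intro sum_nonneg) (auto intro: less_imp_le)
  have pen0: "0 \<le> (\<Sum>u<n. penalty (l' u) (d' u))"
    using penalty_pos by (intro sum_nonneg) (auto intro: less_imp_le)
  \<comment> \<open>All other summands are nonnegative, so \<open>T c < 1\<close> makes the exponent
    in \<open>Tail c\<close> negative and bounds the number of losers.\<close>
  have "Tail c \<le> T c"
    unfolding T_def using Bal0 pen0 pen' by (auto intro!: add_nonneg_nonneg divide_nonneg_nonneg)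
  then have "Tail c < 1" using Tc pot by linarith
  then have "X c \<le> (p + 2 * \<theta>) * x"
    using \<theta> by (simp add: Tail_def mult_less_0_iff)
  moreover have "potential (\<lambda>u. if u \<in> U then F u - {c u} else F u) l' d' \<le> T c"
  proof -
    have "potential (\<lambda>u. if u \<in> U then F u - {c u} else F u) l' d' =
        Bal c / (12 * 2 ^ K) + (\<Sum>u<n. penalty (l' u) (d' u)) / (4 * n)"
      by (simp add: potential_def Bal_def d'_def)
    also have "\<dots> \<le> Bal c / (12 * 2 ^ K) + (R + Psi c) / (4 * n)"
      using pen' by (intro add_left_mono divide_right_mono) auto
    also have "\<dots> \<le> T c" by (simp add: T_def Tail_def)
    finally show ?thesis .
  qed
  ultimately show ?thesis
    using Tc W(1,2) W_X c(1) unfolding l'_def d'_def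
    by (intro exI[of _ c] exI[of _ W]) auto
qed

text \<open>With the full palette free, every weight is exactly \<open>1 / n\<close>, so each of the
  at most \<open>2 ^ K\<close> products is \<open>(1 + 1 / n) ^ n \<le> 3\<close>.\<close>

lemma potential_initial: "potential (\<lambda>_. {..<K}) (\<lambda>_. 0) (\<lambda>_. 0) \<le> 1 / 2"
proof -
  have "balance (\<lambda>_. {..<K}) (\<lambda>_. 0) \<le> (\<Sum>S\<in>{S. S \<subseteq> {..<K} \<and> card S = s}. 3)"
    unfolding balance_def
  proof (rule sum_mono)
    fix S assume S: "S \<in> {S. S \<subseteq> {..<K} \<and> card S = s}"
    then have "{..<K} \<inter> S = S" by auto
    then have "(\<Prod>u<n. 1 + weight S {..<K} 0) = (1 + 1 / n) ^ n"
      using S by (simp add: weight_def)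
    also have "\<dots> \<le> exp (1 / n) ^ n"
      using exp_ge_add_one_self[of "1 / real n"] by (intro power_mono) (auto intro: add_nonneg_nonneg)
    also have "\<dots> = exp 1" using n by (simp add: exp_of_nat_mult[symmetric])
    also have "\<dots> \<le> 3" by (rule exp_le)
    finally show "(\<Prod>u<n. 1 + weight S {..<K} 0) \<le> 3" .
  qed
  also have "\<dots> \<le> 3 * 2 ^ K"
  proof -
    have "card {S. S \<subseteq> {..<K} \<and> card S = s} \<le> card (Pow {..<K})" by (intro card_mono) auto
    then have "real (card {S. S \<subseteq> {..<K} \<and> card S = s}) \<le> 2 ^ K" by (simp add: card_Pow)
    then show ?thesis by simp
  qed
  finally have "balance (\<lambda>_. {..<K}) (\<lambda>_. 0) / (12 * 2 ^ K) \<le> 1 / 4"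
    by (simp add: divide_le_eq)
  moreover have "(\<Sum>u<n. penalty 0 0) / (4 * n) = 1 / 4"
    using n by (simp add: penalty_def)
  ultimately show ?thesis unfolding potential_def by linarith
qed

text \<open>Exceeding the bound gives \<open>u\<close> a penalty of at least
  \<open>exp (\<theta>\<^sup>2 * x) \<ge> 4 * n\<close>, and the potential would reach 1.\<close>

lemma few_losses:
  assumes u: "u < n" and "potential F l d < 1" "real (d u) \<le> x"
  shows "real (l u) \<le> (p + 2 * \<theta>) * x"
proof (rule ccontr)
  assume "\<not> ?thesis"
  then have "\<theta> * ((p + 2 * \<theta>) * x) \<le> \<theta> * l u" using \<theta> by simp
  moreover have "(p * \<theta> + \<theta>\<^sup>2) * d u \<le> (p * \<theta> + \<theta>\<^sup>2) * x"
    using assms(3) \<theta> p_bounds by (intro mult_left_mono) auto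
  ultimately have "\<theta>\<^sup>2 * x \<le> \<theta> * l u - (p * \<theta> + \<theta>\<^sup>2) * d u"
    by (simp add: algebra_simps power2_eq_square)
  then have "exp (\<theta>\<^sup>2 * x) \<le> penalty (l u) (d u)" by (simp add: penalty_def)
  moreover have "4 * n \<le> exp (\<theta>\<^sup>2 * x)"
    using small_tail n by (simp add: exp_minus field_simps)
  moreover have "penalty (l u) (d u) \<le> (\<Sum>u<n. penalty (l u) (d u))"
    using u penalty_pos by (intro member_le_sum) (auto intro: less_imp_le)
  ultimately have "1 \<le> (\<Sum>u<n. penalty (l u) (d u)) / (4 * n)"
    using n by (simp add: le_divide_eq)
  moreover have "0 \<le> balance F d / (12 * 2 ^ K)" using balance_nonneg by simp
  ultimately show False using assms(2) unfolding potential_def by linarith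
qed

end

subsection \<open>Online strategies\<close>

text \<open>Turns the existence of a good next choice into one function of the inputs seen so far,
  which recomputes all its earlier choices.\<close>

lemma online_strategy_exists:
  fixes good :: "'a list \<Rightarrow> 'b list \<Rightarrow> bool"
  assumes start: "good [] []"
    and step: "\<And>Ns N fs. legal (Ns @ [N]) \<Longrightarrow> length fs = length Ns \<Longrightarrow> good Ns fs \<Longrightarrow>
      \<exists>f. good (Ns @ [N]) (fs @ [f])"
    and prefix: "\<And>Ns N. legal (Ns @ [N]) \<Longrightarrow> legal Ns"
  shows "\<exists>B. \<forall>Ns. legal Ns \<longrightarrow> good Ns (map (\<lambda>t. B (take (Suc t) Ns)) [0..<length Ns])"
proof -
  \<comment> \<open>The input is reversed so that the newest arrival is the head and the recursive
    call returns the earlier choices.\<close>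
  define out where "out = rec_list [] (\<lambda>N Ms fs. fs @ [SOME f. good (rev (N # Ms)) (fs @ [f])])"
  have out: "out [] = []"
      "out (N # Ms) = out Ms @ [SOME f. good (rev (N # Ms)) (out Ms @ [f])]" for N Ms
    by (auto simp: out_def)
  define B where "B = (\<lambda>Ns. last (out (rev Ns)))"
  have len: "length (out Ms) = length Ms" for Ms
    by (induction Ms) (auto simp: out)
  have out_eq: "out (rev Ns) = map (\<lambda>t. B (take (Suc t) Ns)) [0..<length Ns]" for Ns
  proof (induction Ns rule: rev_induct)
    case (snoc N Ns)
    have "out (rev (Ns @ [N])) = out (rev Ns) @ [B (Ns @ [N])]"
      by (simp add: B_def out)
    also have "\<dots> = map (\<lambda>t. B (take (Suc t) (Ns @ [N]))) [0..<length Ns] @ [B (Ns @ [N])]"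
      unfolding snoc.IH by simp
    finally show ?case by simp
  qed (simp add: out)
  have "good Ns (out (rev Ns))" if "legal Ns" for Ns
    using that
  proof (induction Ns rule: rev_induct)
    case (snoc N Ns)
    then have "good Ns (out (rev Ns))" using prefix by blast
    then have "\<exists>f. good (Ns @ [N]) (out (rev Ns) @ [f])"
      using snoc.prems by (intro step) (auto simp: len)
    then show ?case by (auto simp: out intro: someI_ex)
  qed (simp add: out start)
  then show ?thesis unfolding out_eq by blast
qed

text \<open>The degree bound is real and the number of arrivals may be smaller than \<open>n\<close>, so that both
  prefixes and residual graphs of legal inputs are legal.\<close>

definition bounded_inputs :: "nat \<Rightarrow> real \<Rightarrow> arrivals set" where
  "bounded_inputs n x = {Ns. length Ns \<le> n \<and> (\<forall>N\<in>set Ns. N \<subseteq> {..<n}) \<and>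
     (\<forall>u. real (offline_degree Ns u) \<le> x) \<and> (\<forall>t. real (online_degree Ns t) \<le> x)}"

lemma offline_degree_snoc:
  "offline_degree (Ns @ [N]) u = offline_degree Ns u + (if u \<in> N then 1 else 0)"
proof -
  have "{t. (u, t) \<in> edges (Ns @ [N])} = {t. (u, t) \<in> edges Ns} \<union> (if u \<in> N then {length Ns} else {})"
    by (auto simp: edges_def nth_append less_Suc_eq)
  moreover have "finite {t. (u, t) \<in> edges Ns}"
    by (rule finite_subset[of _ "{..<length Ns}"]) (auto simp: edges_def)
  moreover have "length Ns \<notin> {t. (u, t) \<in> edges Ns}" by (auto simp: edges_def)
  ultimately show ?thesis by (simp add: offline_degree_def)
qed

lemma online_degree_nth: "t < length Ns \<Longrightarrow> online_degree Ns t = card (Ns ! t)"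
  and online_degree_beyond: "\<not> t < length Ns \<Longrightarrow> online_degree Ns t = 0"
  by (auto simp: online_degree_def edges_def)

lemma bounded_inputs_snocD:
  assumes "Ns @ [N] \<in> bounded_inputs n x"
  shows "Ns \<in> bounded_inputs n x" "N \<subseteq> {..<n}" "real (card N) \<le> x" "length Ns < n"
    "\<And>u. u \<in> N \<Longrightarrow> real (Suc (offline_degree Ns u)) \<le> x"
proof -
  have len: "length (Ns @ [N]) \<le> n" and sub: "\<forall>M\<in>set (Ns @ [N]). M \<subseteq> {..<n}"
    and off: "\<And>u. real (offline_degree (Ns @ [N]) u) \<le> x"
    and onl: "\<And>t. real (online_degree (Ns @ [N]) t) \<le> x"
    using assms by (auto simp: bounded_inputs_def)
  show "N \<subseteq> {..<n}" "length Ns < n" using len sub by auto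
  show "real (card N) \<le> x" using onl[of "length Ns"] by (simp add: online_degree_nth)
  have x: "0 \<le> x" using onl[of 0] by (meson of_nat_0_le_iff order_trans)
  have "real (offline_degree Ns u) \<le> x" for u
    using off[of u] by (simp add: offline_degree_snoc split: if_splits)
  moreover have "real (online_degree Ns t) \<le> x" for t
  proof (cases "t < length Ns")
    case True
    then show ?thesis using onl[of t] by (simp add: online_degree_nth nth_append)
  qed (simp add: online_degree_beyond x)
  ultimately show "Ns \<in> bounded_inputs n x" using len sub by (auto simp: bounded_inputs_def)
  show "real (Suc (offline_degree Ns u)) \<le> x" if "u \<in> N" for u
    using off[of u] that by (simp add: offline_degree_snoc)
qed

section \<open>Residual graphs and composition of partial colorings\<close>

definition residual :: "(arrivals \<Rightarrow> nat \<Rightarrow> nat option) \<Rightarrow> arrivals \<Rightarrow> arrivals" where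
  "residual B Ns = map (\<lambda>t. {u \<in> Ns ! t. B (take (Suc t) Ns) u = None}) [0..<length Ns]"

lemma length_residual [simp]: "length (residual B Ns) = length Ns"
  by (simp add: residual_def)

lemma nth_residual:
  "t < length Ns \<Longrightarrow> residual B Ns ! t = {u \<in> Ns ! t. B (take (Suc t) Ns) u = None}"
  by (simp add: residual_def)

text \<open>The residual graph is itself revealed online: its prefix depends only on the prefix of
  the original input.\<close>

lemma take_residual: "take k (residual B Ns) = residual B (take k Ns)"
proof (rule nth_equalityI)
  fix t assume "t < length (take k (residual B Ns))"
  then show "take k (residual B Ns) ! t = residual B (take k Ns) ! t"
    by (simp add: nth_residual)
qed simp

lemma edges_residual:
  "(u, t) \<in> edges (residual B Ns) \<longleftrightarrow> (u, t) \<in> edges Ns \<and> B (take (Suc t) Ns) u = None"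
  by (auto simp: edges_def nth_residual)

definition partially_colors :: "(arrivals \<Rightarrow> nat \<Rightarrow> nat option) \<Rightarrow> nat \<Rightarrow> arrivals \<Rightarrow> bool" where
  "partially_colors B K Ns \<longleftrightarrow>
     (\<forall>u t a. (u, t) \<in> edges Ns \<longrightarrow> B (take (Suc t) Ns) u = Some a \<longrightarrow> a < K) \<and>
     (\<forall>u t u' t' a. (u, t) \<in> edges Ns \<longrightarrow> (u', t') \<in> edges Ns \<longrightarrow> u = u' \<or> t = t' \<longrightarrow>
        B (take (Suc t) Ns) u = Some a \<longrightarrow> B (take (Suc t') Ns) u' = Some a \<longrightarrow> (u, t) = (u', t'))"

text \<open>Colors are required to lie below \<open>K\<close>, not merely to be few, so that
  successive rounds can use disjoint ranges. A real bound \<open>k\<close> lets the costs of the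
  rounds be added without rounding.\<close>

definition colorable :: "nat \<Rightarrow> real \<Rightarrow> real \<Rightarrow> bool" where
  "colorable n x k \<longleftrightarrow> (\<exists>(a :: arrivals \<Rightarrow> nat \<Rightarrow> nat) K. real K \<le> k \<and>
     (\<forall>Ns\<in>bounded_inputs n x.
        proper_edge_coloring (edges Ns) (\<lambda>(u, t). a (take (Suc t) Ns) u) \<and>
        (\<forall>(u, t)\<in>edges Ns. a (take (Suc t) Ns) u < K)))"

text \<open>The second algorithm runs on the residual graph with its colors shifted by
  \<open>K\<close>.\<close>

lemma colorable_compose:
  assumes B: "\<And>Ns. Ns \<in> bounded_inputs n x \<Longrightarrow>
      partially_colors B K Ns \<and> residual B Ns \<in> bounded_inputs n y"
    and "colorable n y k"
  shows "colorable n x (real K + k)"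
proof -
  obtain a K' where K': "real K' \<le> k" and a: "\<And>Ns. Ns \<in> bounded_inputs n y \<Longrightarrow>
      proper_edge_coloring (edges Ns) (\<lambda>(u, t). a (take (Suc t) Ns) u) \<and>
        (\<forall>(u, t)\<in>edges Ns. a (take (Suc t) Ns) u < K')"
    using assms(2) unfolding colorable_def by blast
  define b where "b = (\<lambda>Ns u. case B Ns u of Some i \<Rightarrow> i | None \<Rightarrow> K + a (residual B Ns) u)"
  have "proper_edge_coloring (edges Ns) (\<lambda>(u, t). b (take (Suc t) Ns) u) \<and>
        (\<forall>(u, t)\<in>edges Ns. b (take (Suc t) Ns) u < K + K')" if Ns: "Ns \<in> bounded_inputs n x" for Ns
  proof -
    define R where "R = residual B Ns"
    have pc: "partially_colors B K Ns" and R: "R \<in> bounded_inputs n y" using B[OF Ns] by (auto simp: R_def)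
    have b: "b (take (Suc t) Ns) u =
        (case B (take (Suc t) Ns) u of Some i \<Rightarrow> i | None \<Rightarrow> K + a (take (Suc t) R) u)" for u t
      by (simp add: b_def R_def take_residual split: option.split)
    have edgeR: "(u, t) \<in> edges R \<longleftrightarrow> (u, t) \<in> edges Ns \<and> B (take (Suc t) Ns) u = None" for u t
      unfolding R_def by (rule edges_residual)
    have lt: "i < K" if "(u, t) \<in> edges Ns" "B (take (Suc t) Ns) u = Some i" for u t i
      using pc that unfolding partially_colors_def by blast
    have "b (take (Suc t) Ns) u \<noteq> b (take (Suc t') Ns) u'"
      if e: "(u, t) \<in> edges Ns" "(u', t') \<in> edges Ns" "(u, t) \<noteq> (u', t')" "u = u' \<or> t = t'" for u t u' t'
    proof (cases "B (take (Suc t) Ns) u")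
      case None
      show ?thesis
      proof (cases "B (take (Suc t') Ns) u'")
        case None': None
        have "(u, t) \<in> edges R" "(u', t') \<in> edges R" using e None None' by (auto simp: edgeR)
        then have "a (take (Suc t) R) u \<noteq> a (take (Suc t') R) u'"
          using a[OF R] e(3,4) unfolding proper_edge_coloring_def by fastforce
        then show ?thesis using None None' by (simp add: b)
      next
        case (Some i)
        then show ?thesis using None lt[OF e(2) Some] by (simp add: b)
      qed
    next
      case (Some i)
      note i = Some
      show ?thesis
      proof (cases "B (take (Suc t') Ns) u'")
        case None
        then show ?thesis using i lt[OF e(1) i] by (simp add: b)
      next
        case (Some j)
        then have "i \<noteq> j" using pc e i unfolding partially_colors_def by blast
        then show ?thesis using i Some by (simp add: b)
      qed
    qed
    then have "proper_edge_coloring (edges Ns) (\<lambda>(u, t). b (take (Suc t) Ns) u)"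
      unfolding proper_edge_coloring_def by fastforce
    moreover have "b (take (Suc t) Ns) u < K + K'" if e: "(u, t) \<in> edges Ns" for u t
    proof (cases "B (take (Suc t) Ns) u")
      case None
      then have "(u, t) \<in> edges R" using e by (simp add: edgeR)
      then show ?thesis using None a[OF R] by (auto simp: b)
    next
      case (Some i)
      then show ?thesis using lt[OF e Some] by (simp add: b)
    qed
    ultimately show ?thesis by auto
  qed
  then show ?thesis unfolding colorable_def using K' by (intro exI[of _ b] exI[of _ "K + K'"]) auto
qed

section \<open>One round as an online strategy\<close>

lemma edges_snoc: "(u, t) \<in> edges (Ns @ [N]) \<longleftrightarrow> (u, t) \<in> edges Ns \<or> t = length Ns \<and> u \<in> N"
  by (auto simp: edges_def nth_append less_Suc_eq)

lemma edge_time_less: "(u, t) \<in> edges Ns \<Longrightarrow> t < length Ns"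
  by (simp add: edges_def)

lemma finite_edge_times: "finite {t. (u, t) \<in> edges Ns \<and> P t}"
  by (rule finite_subset[of _ "{..<length Ns}"]) (auto simp: edges_def)

text \<open>Repeats the single-arrival step while the potential stays below 1. The same degree bound
  for online and offline nodes of the residual graph allows the next round to start.\<close>

lemma (in coloring_round) partial_coloring_exists:
  "\<exists>B. \<forall>Ns\<in>bounded_inputs n x.
     partially_colors B K Ns \<and> residual B Ns \<in> bounded_inputs n ((p + 2 * \<theta>) * x)"
proof -
  define losses where "losses = (\<lambda>Ns (fs :: (nat \<Rightarrow> nat option) list) u.
      card {t. (u, t) \<in> edges Ns \<and> (fs ! t) u = None})"
  \<comment> \<open>\<open>F u\<close> holds the colors not yet drawn at \<open>u\<close>. It is
    kept as a hidden witness because the outputs do not reveal the draws of uncolored edges.\<close>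
  define inv where "inv = (\<lambda>Ns fs F.
      (\<forall>u<n. F u \<subseteq> {..<K} \<and> card (F u) = K - offline_degree Ns u) \<and>
      (\<forall>u t a. (u, t) \<in> edges Ns \<longrightarrow> (fs ! t) u = Some a \<longrightarrow> a < K \<and> a \<notin> F u) \<and>
      (\<forall>u t t' a. (u, t) \<in> edges Ns \<longrightarrow> (u, t') \<in> edges Ns \<longrightarrow>
         (fs ! t) u = Some a \<longrightarrow> (fs ! t') u = Some a \<longrightarrow> t = t') \<and>
      (\<forall>u u' t a. (u, t) \<in> edges Ns \<longrightarrow> (u', t) \<in> edges Ns \<longrightarrow>
         (fs ! t) u = Some a \<longrightarrow> (fs ! t) u' = Some a \<longrightarrow> u = u') \<and>
      (\<forall>t<length Ns. real (card {u \<in> Ns ! t. (fs ! t) u = None}) \<le> (p + 2 * \<theta>) * x) \<and>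
      potential F (losses Ns fs) (offline_degree Ns) \<le> 1 / 2 + length Ns / (4 * n))"
  define good where "good = (\<lambda>Ns fs. \<exists>F. inv Ns fs F)"
  have "\<exists>B. \<forall>Ns. Ns \<in> bounded_inputs n x \<longrightarrow>
      good Ns (map (\<lambda>t. B (take (Suc t) Ns)) [0..<length Ns])"
  proof (rule online_strategy_exists)
    have no_edge: "edges [] = {}" by (simp add: edges_def)
    have "losses [] [] = (\<lambda>_. 0)" "offline_degree [] = (\<lambda>_. 0)"
      by (auto simp: losses_def offline_degree_def no_edge fun_eq_iff)
    then show "good [] []"
      unfolding good_def inv_def using potential_initial
      by (intro exI[of _ "\<lambda>_. {..<K}"]) (simp add: no_edge)
  next
    fix Ns N and fs :: "(nat \<Rightarrow> nat option) list"
    assume legal: "Ns @ [N] \<in> bounded_inputs n x" and len: "length fs = length Ns" and "good Ns fs"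
    note legalD = bounded_inputs_snocD[OF legal]
    obtain F where inv: "inv Ns fs F" using \<open>good Ns fs\<close> unfolding good_def by blast
    have F: "\<And>u. u < n \<Longrightarrow> F u \<subseteq> {..<K}" "\<And>u. u < n \<Longrightarrow> card (F u) = K - offline_degree Ns u"
      and used: "\<And>u t a. (u, t) \<in> edges Ns \<Longrightarrow> (fs ! t) u = Some a \<Longrightarrow> a < K \<and> a \<notin> F u"
      and off: "\<And>u t t' a. (u, t) \<in> edges Ns \<Longrightarrow> (u, t') \<in> edges Ns \<Longrightarrow>
         (fs ! t) u = Some a \<Longrightarrow> (fs ! t') u = Some a \<Longrightarrow> t = t'"
      and onl: "\<And>u u' t a. (u, t) \<in> edges Ns \<Longrightarrow> (u', t) \<in> edges Ns \<Longrightarrow>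
         (fs ! t) u = Some a \<Longrightarrow> (fs ! t) u' = Some a \<Longrightarrow> u = u'"
      and few: "\<And>t. t < length Ns \<Longrightarrow> real (card {u \<in> Ns ! t. (fs ! t) u = None}) \<le> (p + 2 * \<theta>) * x"
      and pot: "potential F (losses Ns fs) (offline_degree Ns) \<le> 1 / 2 + length Ns / (4 * n)"
      using inv unfolding inv_def by blast+
    \<comment> \<open>Counting the new arrival, at most \<open>n\<close> increments of
      \<open>1 / (4 * n)\<close> occur, so the potential never exceeds 3/4.\<close>
    have "real (Suc (length Ns)) / (4 * n) \<le> n / (4 * n)"
      using legalD(4) by (intro divide_right_mono) auto
    also have "\<dots> = 1 / 4" using n by simp
    finally have budget: "length Ns / (4 * n) + 1 / (4 * n) \<le> 1 / 4" by (simp add: add_divide_distrib)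
    then have pot1: "potential F (losses Ns fs) (offline_degree Ns) + 1 / (4 * n) < 1" using pot by linarith
    have FN: "F u \<subseteq> {..<K}" "card (F u) = K - offline_degree Ns u" if "u \<in> N" for u
      using F[of u] legalD(2) that by auto
    obtain c W where c: "\<And>u. u \<in> N \<Longrightarrow> c u \<in> F u" and W: "W \<subseteq> N" and inj: "inj_on c (N - W)"
      and cardW: "real (card W) \<le> (p + 2 * \<theta>) * x"
      and pot': "potential (\<lambda>u. if u \<in> N then F u - {c u} else F u)
        (\<lambda>u. if u \<in> W then Suc (losses Ns fs u) else losses Ns fs u)
        (\<lambda>u. if u \<in> N then Suc (offline_degree Ns u) else offline_degree Ns u)
          \<le> potential F (losses Ns fs) (offline_degree Ns) + 1 / (4 * n)"
      using round_step[OF legalD(2,3,5) FN pot1] by blast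
    \<comment> \<open>Losers stay uncolored, yet their drawn colors leave the free sets too. The
      size of a free set thus depends on the degree alone.\<close>
    define f where "f = (\<lambda>u. if u \<in> W then None else Some (c u))"
    have old: "(fs @ [f]) ! t = fs ! t" if "(u, t) \<in> edges Ns" for u t
      using edge_time_less[OF that] len by (simp add: nth_append)
    have new: "(fs @ [f]) ! length Ns = f" using len by (metis nth_append_length)
    have f_None: "f u = None \<longleftrightarrow> u \<in> W" and f_Some: "f u = Some a \<longleftrightarrow> u \<notin> W \<and> c u = a" for u a
      by (auto simp: f_def)
    have fresh: "(u, length Ns) \<notin> edges Ns" for u by (auto simp: edges_def)
    have losses': "losses (Ns @ [N]) (fs @ [f]) =
        (\<lambda>u. if u \<in> W then Suc (losses Ns fs u) else losses Ns fs u)"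
    proof
      fix u
      have "{t. (u, t) \<in> edges (Ns @ [N]) \<and> ((fs @ [f]) ! t) u = None} =
          {t. (u, t) \<in> edges Ns \<and> (fs ! t) u = None} \<union> (if u \<in> W then {length Ns} else {})"
        using W by (auto simp: edges_snoc old new f_None)
      then show "losses (Ns @ [N]) (fs @ [f]) u = (if u \<in> W then Suc (losses Ns fs u) else losses Ns fs u)"
        using finite_edge_times fresh by (simp add: losses_def)
    qed
    have degree': "offline_degree (Ns @ [N]) =
        (\<lambda>u. if u \<in> N then Suc (offline_degree Ns u) else offline_degree Ns u)"
      by (auto simp: offline_degree_snoc)
    have "good (Ns @ [N]) (fs @ [f])"
      unfolding good_def inv_def
    proof (intro exI[of _ "\<lambda>u. if u \<in> N then F u - {c u} else F u"] conjI allI impI)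
      fix u assume u: "u < n"
      show "(if u \<in> N then F u - {c u} else F u) \<subseteq> {..<K}" using F(1)[OF u] by auto
      show "card (if u \<in> N then F u - {c u} else F u) = K - offline_degree (Ns @ [N]) u"
        using F(2)[OF u] c[of u] by (auto simp: degree')
    next
      fix u t a
      assume "(u, t) \<in> edges (Ns @ [N])" "((fs @ [f]) ! t) u = Some a"
      then consider "(u, t) \<in> edges Ns" "(fs ! t) u = Some a" | "t = length Ns" "u \<in> N" "c u = a"
        by (auto simp: edges_snoc old new f_Some)
      then have "a < K \<and> a \<notin> (if u \<in> N then F u - {c u} else F u)"
      proof cases
        case 1
        then show ?thesis using used[of u t a] by auto
      next
        case 2
        then show ?thesis using c[of u] FN(1)[of u] by auto
      qed
      then show "a < K" "a \<notin> (if u \<in> N then F u - {c u} else F u)" by blast+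
    next
      fix u t t' a
      assume "(u, t) \<in> edges (Ns @ [N])" "(u, t') \<in> edges (Ns @ [N])"
        "((fs @ [f]) ! t) u = Some a" "((fs @ [f]) ! t') u = Some a"
      \<comment> \<open>A color drawn now comes from the old \<open>F u\<close>, which contains no
        color given earlier to an edge at \<open>u\<close>.\<close>
      then show "t = t'"
        using off[of u t t' a] used[of u t a] used[of u t' a] c[of u]
        by (auto simp: edges_snoc old new f_Some)
    next
      fix u u' t a
      assume "(u, t) \<in> edges (Ns @ [N])" "(u', t) \<in> edges (Ns @ [N])"
        "((fs @ [f]) ! t) u = Some a" "((fs @ [f]) ! t) u' = Some a"
      then show "u = u'"
        using onl[of u t u' a] inj_onD[OF inj, of u u'] fresh
        by (auto simp: edges_snoc old new f_Some)
    next
      fix t assume "t < length (Ns @ [N])"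
      then consider "t < length Ns" | "t = length Ns" by fastforce
      then show "real (card {u \<in> (Ns @ [N]) ! t. ((fs @ [f]) ! t) u = None}) \<le> (p + 2 * \<theta>) * x"
      proof cases
        case 1
        then show ?thesis using few[OF 1] len by (simp add: nth_append)
      next
        case 2
        have "{u \<in> N. f u = None} = W" using W by (auto simp: f_None)
        then show ?thesis using 2 cardW new by simp
      qed
    next
      show "potential (\<lambda>u. if u \<in> N then F u - {c u} else F u) (losses (Ns @ [N]) (fs @ [f]))
          (offline_degree (Ns @ [N])) \<le> 1 / 2 + length (Ns @ [N]) / (4 * n)"
        unfolding losses' degree' using pot' pot by (simp add: add_divide_distrib)
    qed
    then show "\<exists>f. good (Ns @ [N]) (fs @ [f])" by blast
  qed (rule bounded_inputs_snocD(1))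
  then obtain B where B: "\<And>Ns. Ns \<in> bounded_inputs n x \<Longrightarrow>
      good Ns (map (\<lambda>t. B (take (Suc t) Ns)) [0..<length Ns])" by blast
  have "partially_colors B K Ns \<and> residual B Ns \<in> bounded_inputs n ((p + 2 * \<theta>) * x)"
    if Ns: "Ns \<in> bounded_inputs n x" for Ns
  proof -
    define fs where "fs = map (\<lambda>t. B (take (Suc t) Ns)) [0..<length Ns]"
    have fs: "fs ! t = B (take (Suc t) Ns)" if "t < length Ns" for t using that by (simp add: fs_def)
    have legal: "length Ns \<le> n" "\<And>N. N \<in> set Ns \<Longrightarrow> N \<subseteq> {..<n}"
        "\<And>u. real (offline_degree Ns u) \<le> x"
      using Ns by (auto simp: bounded_inputs_def)
    obtain F where inv: "inv Ns fs F" using B[OF Ns] unfolding good_def fs_def by blast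
    have used: "\<And>u t a. (u, t) \<in> edges Ns \<Longrightarrow> (fs ! t) u = Some a \<Longrightarrow> a < K"
      and off: "\<And>u t t' a. (u, t) \<in> edges Ns \<Longrightarrow> (u, t') \<in> edges Ns \<Longrightarrow>
         (fs ! t) u = Some a \<Longrightarrow> (fs ! t') u = Some a \<Longrightarrow> t = t'"
      and onl: "\<And>u u' t a. (u, t) \<in> edges Ns \<Longrightarrow> (u', t) \<in> edges Ns \<Longrightarrow>
         (fs ! t) u = Some a \<Longrightarrow> (fs ! t) u' = Some a \<Longrightarrow> u = u'"
      and few: "\<And>t. t < length Ns \<Longrightarrow> real (card {u \<in> Ns ! t. (fs ! t) u = None}) \<le> (p + 2 * \<theta>) * x"
      and pot: "potential F (losses Ns fs) (offline_degree Ns) \<le> 1 / 2 + length Ns / (4 * n)"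
      using inv unfolding inv_def by blast+
    have edge_fs: "fs ! t = B (take (Suc t) Ns)" if "(u, t) \<in> edges Ns" for u t
      using fs edge_time_less[OF that] .
    have "partially_colors B K Ns"
      unfolding partially_colors_def
    proof (intro conjI allI impI)
      fix u t a assume "(u, t) \<in> edges Ns" "B (take (Suc t) Ns) u = Some a"
      then show "a < K" using used[of u t a] by (simp add: edge_fs)
    next
      fix u t u' t' a
      assume "(u, t) \<in> edges Ns" "(u', t') \<in> edges Ns" "u = u' \<or> t = t'"
        "B (take (Suc t) Ns) u = Some a" "B (take (Suc t') Ns) u' = Some a"
      then show "(u, t) = (u', t')" using off[of u t t' a] onl[of u t u' a] by (auto simp: edge_fs)
    qed
    \<comment> \<open>Offline degrees are bounded through the penalties, online degrees through the
      number of losers at each arrival.\<close>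
    moreover have "residual B Ns \<in> bounded_inputs n ((p + 2 * \<theta>) * x)"
      unfolding bounded_inputs_def
    proof (intro CollectI conjI allI)
      show "length (residual B Ns) \<le> n" using legal by simp
      show "\<forall>N\<in>set (residual B Ns). N \<subseteq> {..<n}"
        using legal(2) by (auto simp: residual_def) (meson lessThan_iff nth_mem subsetD)
      have nonneg: "0 \<le> (p + 2 * \<theta>) * x"
        using p_bounds \<theta> x_pos by (intro mult_nonneg_nonneg) auto
      fix u
      have deg: "offline_degree (residual B Ns) u = losses Ns fs u"
        unfolding offline_degree_def losses_def edges_residual
        by (rule arg_cong[of _ _ card]) (auto simp: edge_fs)
      show "real (offline_degree (residual B Ns) u) \<le> (p + 2 * \<theta>) * x"
      proof (cases "u < n")
        case True
        have "length Ns / (4 * n) \<le> n / (4 * n)" using legal(1) by (intro divide_right_mono) auto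
        also have "\<dots> = 1 / 4" using n by simp
        finally have "potential F (losses Ns fs) (offline_degree Ns) < 1" using pot by linarith
        then show ?thesis using few_losses[OF True] legal(3) deg by metis
      next
        case False
        then have "{t. (u, t) \<in> edges Ns \<and> (fs ! t) u = None} = {}"
          using legal(2) by (auto simp: edges_def) (meson lessThan_iff nth_mem subsetD)
        then have "losses Ns fs u = 0" by (simp only: losses_def card.empty)
        then show ?thesis using deg nonneg by simp
      qed
    next
      fix t
      show "real (online_degree (residual B Ns) t) \<le> (p + 2 * \<theta>) * x"
      proof (cases "t < length Ns")
        case True
        then show ?thesis using few[OF True] by (simp add: online_degree_nth nth_residual fs)
      next
        case False
        have "0 \<le> (p + 2 * \<theta>) * x"
          using p_bounds \<theta> x_pos by (intro mult_nonneg_nonneg) auto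
        then show ?thesis using False by (simp add: online_degree_beyond)
      qed
    qed
    ultimately show ?thesis by blast
  qed
  then show ?thesis by blast
qed

section \<open>Greedy coloring\<close>

lemma injective_choice_avoiding:
  fixes Used :: "'a \<Rightarrow> nat set"
  assumes "finite N" "\<And>u. u \<in> N \<Longrightarrow> finite (Used u) \<and> card (Used u) + card N \<le> K"
  shows "\<exists>c. inj_on c N \<and> (\<forall>u\<in>N. c u < K \<and> c u \<notin> Used u)"
  using assms
proof (induction N rule: finite_induct)
  case (insert u N)
  have "finite (Used v) \<and> card (Used v) + card N \<le> K" if "v \<in> N" for v
    using insert.prems[of v] that insert.hyps by simp
  then obtain c where c: "inj_on c N" "\<forall>v\<in>N. c v < K \<and> c v \<notin> Used v"
    using insert.IH by blast
  \<comment> \<open>The colors forbidden for \<open>u\<close> are those in \<open>Used u\<close> and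
    those just given to its siblings, fewer than \<open>K\<close> together.\<close>
  have "card (Used u \<union> c ` N) \<le> card (Used u) + card N"
    using card_Un_le[of "Used u" "c ` N"] card_image_le[OF insert.hyps(1), of c] by linarith
  also have "\<dots> < card {..<K}" using insert.prems[of u] insert.hyps by simp
  finally have "\<not> {..<K} \<subseteq> Used u \<union> c ` N"
    using insert.prems[of u] insert.hyps by (metis card_mono finite_UnI finite_imageI insertI1 not_le)
  then obtain a where a: "a < K" "a \<notin> Used u" "a \<notin> c ` N" by auto
  have "inj_on (c(u := a)) (insert u N)"
    using c(1) a(3) insert.hyps by (auto simp: inj_on_def)
  moreover have "\<forall>v\<in>insert u N. (c(u := a)) v < K \<and> (c(u := a)) v \<notin> Used v"
    using c(2) a insert.hyps by auto
  ultimately show ?case by blast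
qed simp

text \<open>Each new edge meets fewer than \<open>D\<close> earlier edges at its offline end and
  fewer than \<open>D\<close> siblings at its online end.\<close>

lemma colorable_greedy:
  assumes "0 \<le> x"
  shows "colorable n x (2 * x)"
proof -
  \<comment> \<open>Degrees are integers, so the real bound \<open>x\<close> acts through its
    floor.\<close>
  define D where "D = nat \<lfloor>x\<rfloor>"
  define K where "K = 2 * D"
  have D: "real k \<le> x \<longleftrightarrow> k \<le> D" for k
    using assms by (simp add: D_def le_nat_iff le_floor_iff)
  define good where "good = (\<lambda>Ns (fs :: (nat \<Rightarrow> nat) list).
      proper_edge_coloring (edges Ns) (\<lambda>(u, t). (fs ! t) u) \<and> (\<forall>(u, t)\<in>edges Ns. (fs ! t) u < K))"
  have "\<exists>a. \<forall>Ns. Ns \<in> bounded_inputs n x \<longrightarrow> good Ns (map (\<lambda>t. a (take (Suc t) Ns)) [0..<length Ns])"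
  proof (rule online_strategy_exists)
    show "good [] []" by (auto simp: good_def edges_def proper_edge_coloring_def)
  next
    fix Ns N and fs :: "(nat \<Rightarrow> nat) list"
    assume legal: "Ns @ [N] \<in> bounded_inputs n x" and len: "length fs = length Ns" and good: "good Ns fs"
    note legalD = bounded_inputs_snocD[OF legal]
    have fin: "finite N" using legalD(2) finite_subset by blast
    define Used where "Used = (\<lambda>u. (\<lambda>t. (fs ! t) u) ` {t. (u, t) \<in> edges Ns})"
    have avail: "finite (Used u) \<and> card (Used u) + card N \<le> K" if "u \<in> N" for u
    proof
      have fint: "finite {t. (u, t) \<in> edges Ns}" using finite_edge_times[of u Ns "\<lambda>_. True"] by simp
      then show "finite (Used u)" by (simp add: Used_def)
      have "card (Used u) \<le> offline_degree Ns u"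
        unfolding Used_def offline_degree_def using fint by (rule card_image_le)
      moreover have "Suc (offline_degree Ns u) \<le> D" using legalD(5)[OF that] D by blast
      moreover have "card N \<le> D" using legalD(3) D by blast
      ultimately show "card (Used u) + card N \<le> K" by (simp add: K_def)
    qed
    obtain c where c: "inj_on c N" "\<And>u. u \<in> N \<Longrightarrow> c u < K \<and> c u \<notin> Used u"
      using injective_choice_avoiding[where N = N and Used = Used, OF fin avail] by blast
    have old: "(fs @ [c]) ! t = fs ! t" if "(u, t) \<in> edges Ns" for u t
      using edge_time_less[OF that] len by (simp add: nth_append)
    have new: "(fs @ [c]) ! length Ns = c" using len by (metis nth_append_length)
    have fresh: "(u, length Ns) \<notin> edges Ns" for u by (auto simp: edges_def)
    have avoid: "(fs ! t) u \<noteq> c u" if "(u, t) \<in> edges Ns" "u \<in> N" for u t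
    proof -
      have "(fs ! t) u \<in> Used u" unfolding Used_def using that(1) by (intro image_eqI[of _ _ t]) auto
      then show ?thesis using c(2)[OF that(2)] by auto
    qed
    have proper: "(fs ! t) u \<noteq> (fs ! t') u'"
      if "(u, t) \<in> edges Ns" "(u', t') \<in> edges Ns" "(u, t) \<noteq> (u', t')" "u = u' \<or> t = t'" for u t u' t'
      using good that unfolding good_def proper_edge_coloring_def by fastforce
    have "((fs @ [c]) ! t) u \<noteq> ((fs @ [c]) ! t') u'"
      if e: "(u, t) \<in> edges (Ns @ [N])" "(u', t') \<in> edges (Ns @ [N])" "(u, t) \<noteq> (u', t')" "u = u' \<or> t = t'"
      for u t u' t'
    proof -
      consider "(u, t) \<in> edges Ns" "(u', t') \<in> edges Ns"
        | "(u, t) \<in> edges Ns" "t' = length Ns" "u' \<in> N"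
        | "t = length Ns" "u \<in> N" "(u', t') \<in> edges Ns"
        | "t = length Ns" "u \<in> N" "t' = length Ns" "u' \<in> N"
        using e by (auto simp: edges_snoc)
      then show ?thesis
      proof cases
        case 1
        then show ?thesis using proper e by (simp add: old)
      next
        case 2
        then have "u = u'" using e fresh by auto
        then show ?thesis using 2 avoid by (simp add: old new)
      next
        case 3
        then have "u = u'" using e fresh by auto
        then show ?thesis using 3 avoid[of u t'] by (metis old new)
      next
        case 4
        then show ?thesis using e c(1) by (auto simp: new inj_on_def)
      qed
    qed
    then have "proper_edge_coloring (edges (Ns @ [N])) (\<lambda>(u, t). ((fs @ [c]) ! t) u)"
      unfolding proper_edge_coloring_def by fastforce
    moreover have "((fs @ [c]) ! t) u < K" if "(u, t) \<in> edges (Ns @ [N])" for u t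
      using that good c(2) by (auto simp: edges_snoc old new good_def)
    ultimately have "good (Ns @ [N]) (fs @ [c])" unfolding good_def by blast
    then show "\<exists>f. good (Ns @ [N]) (fs @ [f])" by blast
  qed (rule bounded_inputs_snocD(1))
  then obtain a where a: "\<And>Ns. Ns \<in> bounded_inputs n x \<Longrightarrow>
      good Ns (map (\<lambda>t. a (take (Suc t) Ns)) [0..<length Ns])" by blast
  have "proper_edge_coloring (edges Ns) (\<lambda>(u, t). a (take (Suc t) Ns) u) \<and>
      (\<forall>(u, t)\<in>edges Ns. a (take (Suc t) Ns) u < K)" if "Ns \<in> bounded_inputs n x" for Ns
  proof -
    define fs where "fs = map (\<lambda>t. a (take (Suc t) Ns)) [0..<length Ns]"
    have "(case e of (u, t) \<Rightarrow> (fs ! t) u) = (case e of (u, t) \<Rightarrow> a (take (Suc t) Ns) u)"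
      if "e \<in> edges Ns" for e
      using that edge_time_less by (cases e) (simp add: fs_def)
    moreover have "proper_edge_coloring (edges Ns) (\<lambda>(u, t). (fs ! t) u)"
        "\<forall>e\<in>edges Ns. (case e of (u, t) \<Rightarrow> (fs ! t) u) < K"
      using a[OF that] by (auto simp: good_def fs_def)
    ultimately have "proper_edge_coloring (edges Ns) (\<lambda>(u, t). a (take (Suc t) Ns) u)"
        "\<forall>e\<in>edges Ns. (case e of (u, t) \<Rightarrow> a (take (Suc t) Ns) u) < K"
      unfolding proper_edge_coloring_def by simp_all
    then show ?thesis by auto
  qed
  moreover have "real K \<le> 2 * x" using D[of D] by (simp add: K_def)
  ultimately show ?thesis unfolding colorable_def by blast
qed

section \<open>Iterating the rounds\<close>

lemma nat_ceiling_less_add_one: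
  fixes y :: real
  assumes "0 \<le> y"
  shows "real (nat \<lceil>y\<rceil>) < y + 1"
proof -
  have "0 \<le> \<lceil>y\<rceil>" using assms by simp
  then have "real (nat \<lceil>y\<rceil>) = of_int \<lceil>y\<rceil>" by simp
  then show ?thesis using ceiling_correct[of y] by linarith
qed

lemma colorable_mono: "colorable n x k \<Longrightarrow> k \<le> k' \<Longrightarrow> colorable n x k'"
  unfolding colorable_def using order_trans by blast

text \<open>Each round multiplies the degree bound by \<open>\<rho>\<close>, and greedy coloring
  finishes after \<open>L\<close> rounds. Largeness of \<open>\<rho> ^ L * x\<close>, the smallest
  bound that occurs, covers every round.\<close>

lemma colorable_rounds:
  fixes \<theta> x :: real and n L :: nat
  defines "\<rho> \<equiv> exp (- 1) + 6 * \<theta>"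
  assumes \<theta>: "0 < \<theta>" "\<theta> \<le> 1 / 20" and n: "1 \<le> n" and large: "4 * ln (real n) + 24 \<le> \<theta> ^ 8 * (\<rho> ^ L * x)"
  shows "colorable n x ((1 + 2 * \<theta>) * x * (\<Sum>i<L. \<rho> ^ i) + 2 * (\<rho> ^ L * x))"
  using large
proof (induction L arbitrary: x)
  have e: "exp (- 1 :: real) \<le> 1 / 2"
    using exp_ge_add_one_self[of "1::real"] by (simp add: exp_minus field_simps)
  have \<rho>: "0 < \<rho>" "\<rho> \<le> 1" using \<theta> e by (auto simp: \<rho>_def add_pos_pos)
  have ln0: "0 \<le> ln (real n)" using n by simp
  {
    case 0
    then have "0 < \<theta> ^ 8 * x" using ln0 by simp
    then have "0 \<le> x" using \<theta> by (simp add: zero_less_mult_iff)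
    then show ?case using colorable_greedy by simp
  next
    case (Suc L)
    have "0 < \<theta> ^ 8 * (\<rho> ^ Suc L * x)" using Suc.prems ln0 by linarith
    then have x: "0 < x" using \<theta>(1) \<rho>(1) by (metis zero_less_mult_pos zero_less_power)
    have "\<rho> ^ Suc L * x \<le> 1 * x" using x \<rho> by (intro mult_right_mono power_le_one) auto
    then have "\<theta> ^ 8 * (\<rho> ^ Suc L * x) \<le> \<theta> ^ 8 * x" using \<theta> by (intro mult_left_mono) auto
    then have large: "4 * ln (real n) + 24 \<le> \<theta> ^ 8 * x" using Suc.prems by linarith
    define K where "K = nat \<lceil>(1 + \<theta>) * x\<rceil>"
    define s where "s = nat \<lceil>\<theta>\<^sup>2 * x\<rceil>"
    \<comment> \<open>From \<open>1 \<le> \<theta> * x\<close>, rounding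
      \<open>(1 + \<theta>) * x\<close> up to \<open>K\<close> stays within
      \<open>(1 + 2 * \<theta>) * x\<close>.\<close>
    have "\<theta> ^ 8 * x \<le> \<theta> ^ 1 * x" using \<theta> x by (intro mult_right_mono power_decreasing) auto
    then have \<theta>x: "1 \<le> \<theta> * x" using large ln0 by simp
    have "real K < (1 + \<theta>) * x + 1" "(1 + \<theta>) * x \<le> real K"
      unfolding K_def using x \<theta> by (intro nat_ceiling_less_add_one real_nat_ceiling_ge mult_nonneg_nonneg; simp)+
    then have K_bounds: "real K \<le> (1 + 2 * \<theta>) * x" "(1 + \<theta>) * x \<le> real K"
      using \<theta>x by (auto simp: algebra_simps)
    interpret coloring_round n K s \<theta> x
    proof
      show "\<theta>\<^sup>2 * x \<le> real s" unfolding s_def by (rule real_nat_ceiling_ge)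
      show "real s < \<theta>\<^sup>2 * x + 1" unfolding s_def using x by (intro nat_ceiling_less_add_one) simp
    qed (use n \<theta> large K_bounds in auto)
    have p\<rho>: "p + 2 * \<theta> = \<rho>" by (simp add: p_def \<rho>_def)
    have "colorable n (\<rho> * x) ((1 + 2 * \<theta>) * (\<rho> * x) * (\<Sum>i<L. \<rho> ^ i) + 2 * (\<rho> ^ L * (\<rho> * x)))"
      using Suc.prems by (intro Suc.IH) (simp add: mult_ac)
    moreover obtain B where "\<forall>Ns\<in>bounded_inputs n x.
        partially_colors B K Ns \<and> residual B Ns \<in> bounded_inputs n (\<rho> * x)"
      using partial_coloring_exists unfolding p\<rho> by blast
    ultimately have "colorable n x (real K + ((1 + 2 * \<theta>) * (\<rho> * x) * (\<Sum>i<L. \<rho> ^ i) + 2 * (\<rho> ^ L * (\<rho> * x))))"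
      using colorable_compose by blast
    moreover have "(1 + 2 * \<theta>) * x * (\<Sum>i<Suc L. \<rho> ^ i) =
        (1 + 2 * \<theta>) * x + (1 + 2 * \<theta>) * (\<rho> * x) * (\<Sum>i<L. \<rho> ^ i)"
      unfolding sum.lessThan_Suc_shift by (simp add: sum_distrib_left sum.distrib distrib_left mult_ac)
    ultimately show ?case
      using K_bounds(1) by (elim colorable_mono) (simp add: mult_ac)
  }
qed

subsection \<open>Competitive ratio\<close>

text \<open>Both \<open>\<theta>\<close> and the number \<open>L\<close> of rounds depend only on
  \<open>\<epsilon>\<close>, so the requirement on \<open>x\<close> is a constant times
  \<open>ln n + 1\<close>. Half of \<open>\<epsilon>\<close> pays for the geometric series and half
  for the greedy end.\<close>

lemma colorable_asymptotic:
  fixes \<epsilon> :: real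
  assumes \<epsilon>: "0 < \<epsilon>"
  shows "\<exists>C>0. \<forall>n x. 1 \<le> n \<longrightarrow> C * (ln (real n) + 1) \<le> x \<longrightarrow>
    colorable n x ((exp 1 / (exp 1 - 1) + \<epsilon>) * x)"
proof -
  define r where "r = 1 - exp (- 1 :: real)"
  \<comment> \<open>The bound \<open>1 / 60\<close> gives \<open>\<rho> \<le> 3 / 5\<close>; the
    bound \<open>\<epsilon> / 80\<close> makes the error \<open>40 * \<theta>\<close> of the series
    at most \<open>\<epsilon> / 2\<close>.\<close>
  define \<theta> where "\<theta> = min (1 / 60) (\<epsilon> / 80)"
  define \<rho> where "\<rho> = exp (- 1) + 6 * \<theta>"
  have \<theta>: "0 < \<theta>" "\<theta> \<le> 1 / 60" "\<theta> \<le> \<epsilon> / 80" using \<epsilon> by (auto simp: \<theta>_def)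
  have "exp (- 1 :: real) \<le> 1 / 2"
    using exp_ge_add_one_self[of "1::real"] by (simp add: exp_minus field_simps)
  then have r: "1 / 2 \<le> r" "r \<le> 1" by (auto simp: r_def)
  have \<rho>: "0 < \<rho>" "\<rho> \<le> 3 / 5" "1 - \<rho> = r - 6 * \<theta>" using \<theta> r by (auto simp: \<rho>_def r_def add_pos_pos)
  have ratio: "exp 1 / (exp 1 - 1) = 1 / r"
    by (simp add: r_def exp_minus field_simps)
  have geometric: "(1 + 2 * \<theta>) / (1 - \<rho>) \<le> 1 / r + \<epsilon> / 2"
  proof -
    have r6: "2 / 5 \<le> r - 6 * \<theta>" using r \<theta> by simp
    have "1 / 5 \<le> r * (r - 6 * \<theta>)"
      using mult_mono[OF r(1) r6] r by simp
    have "(1 + 2 * \<theta>) / (r - 6 * \<theta>) = 1 / r + (2 * r + 6) * \<theta> / (r * (r - 6 * \<theta>))"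
      using r r6 by (simp add: field_simps)
    also have "(2 * r + 6) * \<theta> / (r * (r - 6 * \<theta>)) \<le> 8 * \<theta> / (1 / 5)"
      using r \<theta> \<open>1 / 5 \<le> r * (r - 6 * \<theta>)\<close> by (intro frac_le mult_right_mono mult_nonneg_nonneg) auto
    also have "\<dots> \<le> \<epsilon> / 2" using \<theta> by simp
    finally show ?thesis by (simp add: \<rho>(3))
  qed
  obtain L where L: "\<rho> ^ L < \<epsilon> / 4"
    using real_arch_pow_inv[of "\<epsilon> / 4" \<rho>] \<epsilon> \<rho> by auto
  \<comment> \<open>Since \<open>ln n \<ge> 0\<close>, \<open>24 * (ln n + 1)\<close> dominates the
    required \<open>4 * ln n + 24\<close>.\<close>
  define C where "C = 24 / (\<theta> ^ 8 * \<rho> ^ L)"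
  have q: "0 < \<theta> ^ 8 * \<rho> ^ L" using \<theta> \<rho> by simp
  have "colorable n x ((exp 1 / (exp 1 - 1) + \<epsilon>) * x)"
    if n: "1 \<le> n" and x: "C * (ln (real n) + 1) \<le> x" for n x
  proof -
    have ln0: "0 \<le> ln (real n)" using n by simp
    have "0 \<le> C * (ln (real n) + 1)" using q ln0 by (simp add: C_def)
    then have x0: "0 \<le> x" using x by linarith
    have "24 * (ln (real n) + 1) = \<theta> ^ 8 * \<rho> ^ L * (C * (ln (real n) + 1))"
      using \<theta>(1) \<rho>(1) by (simp add: C_def)
    also have "\<dots> \<le> \<theta> ^ 8 * \<rho> ^ L * x" using x q by (intro mult_left_mono) auto
    finally have "4 * ln (real n) + 24 \<le> \<theta> ^ 8 * (\<rho> ^ L * x)" using ln0 by (simp add: mult.assoc)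
    then have "colorable n x ((1 + 2 * \<theta>) * x * (\<Sum>i<L. \<rho> ^ i) + 2 * (\<rho> ^ L * x))"
      unfolding \<rho>_def using \<theta> n by (intro colorable_rounds) auto
    moreover have "(1 + 2 * \<theta>) * x * (\<Sum>i<L. \<rho> ^ i) + 2 * (\<rho> ^ L * x) \<le> (exp 1 / (exp 1 - 1) + \<epsilon>) * x"
    proof -
      have "(\<Sum>i<L. \<rho> ^ i) = (1 - \<rho> ^ L) / (1 - \<rho>)" using \<rho> by (simp add: sum_gp_strict)
      also have "\<dots> \<le> 1 / (1 - \<rho>)" using \<rho> by (intro divide_right_mono) auto
      finally have "(1 + 2 * \<theta>) * x * (\<Sum>i<L. \<rho> ^ i) \<le> (1 + 2 * \<theta>) * x * (1 / (1 - \<rho>))"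
        using \<theta> x0 by (intro mult_left_mono) auto
      also have "\<dots> = (1 + 2 * \<theta>) / (1 - \<rho>) * x" by simp
      also have "\<dots> \<le> (1 / r + \<epsilon> / 2) * x" using geometric x0 by (intro mult_right_mono)
      finally have "(1 + 2 * \<theta>) * x * (\<Sum>i<L. \<rho> ^ i) \<le> (1 / r + \<epsilon> / 2) * x" .
      moreover have "2 * (\<rho> ^ L * x) \<le> \<epsilon> / 2 * x"
        using mult_right_mono[of "\<rho> ^ L" "\<epsilon> / 4" x] L x0 by simp
      ultimately show ?thesis by (simp add: ratio algebra_simps)
    qed
    ultimately show ?thesis by (rule colorable_mono)
  qed
  moreover have "0 < C" using q by (simp add: C_def)
  ultimately show ?thesis by blast
qed

section \<open>Optimal strategies for fixed parameters\<close>

definition achieves :: "nat \<Rightarrow> nat \<Rightarrow> (arrivals \<Rightarrow> nat \<Rightarrow> nat) \<Rightarrow> nat \<Rightarrow> bool" where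
  "achieves n \<Delta> a k \<longleftrightarrow> (\<forall>Ns\<in>online_inputs n. max_degree n Ns = \<Delta> \<longrightarrow>
     proper_edge_coloring (edges Ns) (\<lambda>(u, t). a (take (Suc t) Ns) u) \<and>
     card ((\<lambda>(u, t). a (take (Suc t) Ns) u) ` edges Ns) \<le> k)"

definition best :: "nat \<Rightarrow> nat \<Rightarrow> nat" where
  "best n \<Delta> = (LEAST k. \<exists>a. achieves n \<Delta> a k)"

text \<open>An optimal strategy for each pair \<open>(n, \<Delta>)\<close> separately; thus one algorithm serves all
  precisions \<open>\<epsilon>\<close> at once.\<close>

definition best_algorithm :: online_algorithm where
  "best_algorithm n \<Delta> = (SOME a. achieves n \<Delta> a (best n \<Delta>))"

lemma online_input_bounded:
  assumes Ns: "Ns \<in> online_inputs n"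
  shows "Ns \<in> bounded_inputs n (max_degree n Ns)"
proof -
  have sub: "length Ns = n" "\<And>N. N \<in> set Ns \<Longrightarrow> N \<subseteq> {..<n}"
    using Ns by (auto simp: online_inputs_def)
  have "offline_degree Ns u \<le> max_degree n Ns" for u
  proof (cases "u < n")
    case True
    then show ?thesis unfolding max_degree_def by (intro Max_ge) auto
  next
    case False
    then have "{t. (u, t) \<in> edges Ns} = {}"
      using sub(2) by (auto simp: edges_def) (meson lessThan_iff nth_mem subsetD)
    then have "offline_degree Ns u = 0" by (simp only: offline_degree_def card.empty)
    then show ?thesis by simp
  qed
  moreover have "online_degree Ns t \<le> max_degree n Ns" for t
  proof (cases "t < n")
    case True
    then show ?thesis unfolding max_degree_def by (intro Max_ge) auto
  next
    case False
    then show ?thesis using sub(1) by (simp add: online_degree_beyond)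
  qed
  ultimately show ?thesis using sub by (simp add: bounded_inputs_def)
qed

lemma colorable_achieves:
  assumes "colorable n (real \<Delta>) k"
  shows "\<exists>a K. real K \<le> k \<and> achieves n \<Delta> a K"
proof -
  obtain a K where K: "real K \<le> k" and a: "\<And>Ns. Ns \<in> bounded_inputs n \<Delta> \<Longrightarrow>
      proper_edge_coloring (edges Ns) (\<lambda>(u, t). a (take (Suc t) Ns) u) \<and>
        (\<forall>(u, t)\<in>edges Ns. a (take (Suc t) Ns) u < K)"
    using assms unfolding colorable_def by blast
  have "achieves n \<Delta> a K"
    unfolding achieves_def
  proof (intro ballI impI conjI)
    fix Ns assume "Ns \<in> online_inputs n" "max_degree n Ns = \<Delta>"
    then have "Ns \<in> bounded_inputs n \<Delta>" using online_input_bounded by blast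
    note a = a[OF this]
    show "proper_edge_coloring (edges Ns) (\<lambda>(u, t). a (take (Suc t) Ns) u)" using a by blast
    have "(\<lambda>(u, t). a (take (Suc t) Ns) u) ` edges Ns \<subseteq> {..<K}" using a by auto
    then show "card ((\<lambda>(u, t). a (take (Suc t) Ns) u) ` edges Ns) \<le> K"
      using card_mono[of "{..<K}"] by fastforce
  qed
  then show ?thesis using K by blast
qed

lemma best_le: "colorable n (real \<Delta>) k \<Longrightarrow> real (best n \<Delta>) \<le> k"
proof -
  assume "colorable n (real \<Delta>) k"
  then obtain a K where "real K \<le> k" "achieves n \<Delta> a K" using colorable_achieves by blast
  moreover from this have "best n \<Delta> \<le> K" unfolding best_def by (intro Least_le) blast
  ultimately show ?thesis by linarith
qed

text \<open>Greedy coloring shows that some number of colors is achievable, so \<open>LEAST\<close>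
  and \<open>SOME\<close> pick genuine witnesses.\<close>

lemma best_algorithm_achieves: "achieves n \<Delta> (best_algorithm n \<Delta>) (best n \<Delta>)"
proof -
  have "\<exists>k a. achieves n \<Delta> a k"
    using colorable_achieves[OF colorable_greedy[of "real \<Delta>" n]] by auto
  then have "\<exists>a. achieves n \<Delta> a (best n \<Delta>)" unfolding best_def by (rule LeastI_ex)
  then show ?thesis unfolding best_algorithm_def by (rule someI_ex)
qed

lemma output_coloring_best:
  "output_coloring best_algorithm n \<Delta> Ns = (\<lambda>(u, t). best_algorithm n \<Delta> (take (Suc t) Ns) u)"
  by (simp add: output_coloring_def)

lemma competitive_bestI:
  assumes "real (best n \<Delta>) \<le> \<alpha> * real \<Delta>"
  shows "competitive best_algorithm n \<Delta> \<alpha>"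
  unfolding competitive_def output_coloring_best
proof (intro ballI impI)
  fix Ns assume "Ns \<in> online_inputs n" "max_degree n Ns = \<Delta>"
  then have "card ((\<lambda>(u, t). best_algorithm n \<Delta> (take (Suc t) Ns) u) ` edges Ns) \<le> best n \<Delta>"
    using best_algorithm_achieves unfolding achieves_def by blast
  then show "real (card ((\<lambda>(u, t). best_algorithm n \<Delta> (take (Suc t) Ns) u) ` edges Ns)) \<le> \<alpha> * real \<Delta>"
    using assms by linarith
qed

lemma online_edge_coloring_best: "online_edge_coloring_algorithm best_algorithm"
  unfolding online_edge_coloring_algorithm_def output_coloring_best
  using best_algorithm_achieves unfolding achieves_def by blast

text \<open>For \<open>n = 1\<close> the bound \<open>C * ln n\<close> is 0 and says nothing about
  \<open>\<Delta>\<close>; but the graph has at most one edge.\<close>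

lemma competitive_single_node:
  assumes "1 \<le> \<alpha>"
  shows "competitive A 1 \<Delta> \<alpha>"
  unfolding competitive_def
proof (intro ballI impI)
  fix Ns assume Ns: "Ns \<in> online_inputs 1" and \<Delta>: "max_degree 1 Ns = \<Delta>"
  have b: "Ns \<in> bounded_inputs 1 (real \<Delta>)" using online_input_bounded[OF Ns] \<Delta> by simp
  have len: "length Ns = 1" and sub: "\<And>N. N \<in> set Ns \<Longrightarrow> N \<subseteq> {..<1}"
    using Ns by (auto simp: online_inputs_def)
  have "Ns ! 0 \<subseteq> {..<1}" using len by (intro sub nth_mem) simp
  then have E: "edges Ns \<subseteq> {(0, 0)}" using len by (auto simp: edges_def)
  show "real (card (output_coloring A 1 \<Delta> Ns ` edges Ns)) \<le> \<alpha> * real \<Delta>"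
  proof (cases "edges Ns = {}")
    case True
    then show ?thesis using assms by simp
  next
    case False
    then have "edges Ns = {(0, 0)}" using E by auto
    then have "offline_degree Ns 0 = 1" by (simp add: offline_degree_def)
    then have "1 \<le> real \<Delta>" using b unfolding bounded_inputs_def by (metis (mono_tags, lifting) mem_Collect_eq of_nat_1)
    then have "1 \<le> \<alpha> * real \<Delta>" using assms mult_mono[of 1 \<alpha> 1 "real \<Delta>"] by simp
    then show ?thesis using \<open>edges Ns = {(0, 0)}\<close> by simp
  qed
qed

text \<open>For \<open>n \<ge> 2\<close> the summand 1 in \<open>ln n + 1\<close> is at most
  \<open>ln n / ln 2\<close> and can be absorbed into the constant.\<close>

lemma best_asymptotic:
  assumes "0 < \<epsilon>"
  shows "\<exists>C>0. \<forall>n \<Delta>. 2 \<le> n \<longrightarrow> C * ln (real n) \<le> real \<Delta> \<longrightarrow>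
    real (best n \<Delta>) \<le> (exp 1 / (exp 1 - 1) + \<epsilon>) * real \<Delta>"
proof -
  obtain C where C: "0 < C" "\<And>n x. 1 \<le> n \<Longrightarrow> C * (ln (real n) + 1) \<le> x \<Longrightarrow>
      colorable n x ((exp 1 / (exp 1 - 1) + \<epsilon>) * x)"
    using colorable_asymptotic[OF assms] by blast
  have ln2: "0 < ln (2 :: real)" by simp
  have "real (best n \<Delta>) \<le> (exp 1 / (exp 1 - 1) + \<epsilon>) * real \<Delta>"
    if n: "2 \<le> n" and \<Delta>: "C * (1 + 1 / ln 2) * ln (real n) \<le> real \<Delta>" for n \<Delta>
  proof -
    have "ln 2 \<le> ln (real n)" using n by simp
    then have "1 \<le> ln (real n) / ln 2" using ln2 by (simp add: le_divide_eq)
    then have "ln (real n) + 1 \<le> (1 + 1 / ln 2) * ln (real n)" by (simp add: distrib_right)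
    then have "C * (ln (real n) + 1) \<le> C * ((1 + 1 / ln 2) * ln (real n))"
      using C(1) by (intro mult_left_mono) auto
    then have "C * (ln (real n) + 1) \<le> real \<Delta>" using \<Delta> by (simp add: mult.assoc)
    then show ?thesis using C(2)[of n "real \<Delta>"] n by (intro best_le) auto
  qed
  moreover have "0 < C * (1 + 1 / ln 2)" using C(1) ln2 by (intro mult_pos_pos add_pos_pos) auto
  ultimately show ?thesis by blast
qed

text \<open>The upper bound amounts to \<open>e > 2\<close>, which the quadratic Taylor polynomial
  provides.\<close>

lemma euler_ratio_bounds: "1 \<le> exp 1 / (exp 1 - 1 :: real)" "exp 1 / (exp 1 - 1 :: real) < 2"
proof -
  have "1 + 1 + 1 / 2 \<le> exp (1 :: real)" using exp_lower_Taylor_quadratic[of "1::real"] by simp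
  then show "1 \<le> exp 1 / (exp 1 - 1 :: real)" "exp 1 / (exp 1 - 1 :: real) < 2"
    by (auto simp: field_simps)
qed

theorem theorem3p3:
  shows "\<exists>A :: online_algorithm.
     online_edge_coloring_algorithm A \<and>
     (\<exists>\<alpha> C :: real. \<alpha> < 2 \<and> C > 0 \<and>
        (\<forall>n \<Delta> :: nat. n \<ge> 1 \<and> real \<Delta> \<ge> C * ln (real n) \<longrightarrow> competitive A n \<Delta> \<alpha>)) \<and>
     (\<forall>D :: nat \<Rightarrow> nat. (\<lambda>n. real (D n)) \<in> \<omega>(\<lambda>n. ln (real n)) \<longrightarrow>
        (\<exists>\<epsilon> :: nat \<Rightarrow> real. \<epsilon> \<longlonglongrightarrow> 0 \<and>
           (\<forall>n. competitive A n (D n) (exp 1 / (exp 1 - 1) + \<epsilon> n))))"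
proof (intro exI[of _ best_algorithm] conjI allI impI)
  define \<gamma> where "\<gamma> = exp 1 / (exp 1 - 1 :: real)"
  have \<gamma>: "1 \<le> \<gamma>" "\<gamma> < 2" using euler_ratio_bounds by (auto simp: \<gamma>_def)
  show "online_edge_coloring_algorithm best_algorithm" by (rule online_edge_coloring_best)
  show "\<exists>\<alpha> C :: real. \<alpha> < 2 \<and> C > 0 \<and>
      (\<forall>n \<Delta> :: nat. n \<ge> 1 \<and> real \<Delta> \<ge> C * ln (real n) \<longrightarrow> competitive best_algorithm n \<Delta> \<alpha>)"
  proof -
    \<comment> \<open>Half of the gap between \<open>e / (e - 1)\<close> and 2 keeps the ratio
      strictly below 2.\<close>
    define \<epsilon> where "\<epsilon> = (2 - \<gamma>) / 2"
    have \<epsilon>: "0 < \<epsilon>" "\<gamma> + \<epsilon> < 2" using \<gamma> by (auto simp: \<epsilon>_def field_simps)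
    obtain C where C: "0 < C" "\<And>n \<Delta>. 2 \<le> n \<Longrightarrow> C * ln (real n) \<le> real \<Delta> \<Longrightarrow>
        real (best n \<Delta>) \<le> (\<gamma> + \<epsilon>) * real \<Delta>"
      using best_asymptotic[OF \<epsilon>(1)] unfolding \<gamma>_def by blast
    have "competitive best_algorithm n \<Delta> (\<gamma> + \<epsilon>)" if "n \<ge> 1 \<and> real \<Delta> \<ge> C * ln (real n)" for n \<Delta>
    proof (cases "n = 1")
      case True
      then show ?thesis using competitive_single_node \<gamma> \<epsilon> by simp
    next
      case False
      then show ?thesis using that C(2)[of n \<Delta>] by (intro competitive_bestI) auto
    qed
    then show ?thesis using C(1) \<epsilon>(2) by blast
  qed
  fix D :: "nat \<Rightarrow> nat"
  assume D: "(\<lambda>n. real (D n)) \<in> \<omega>(\<lambda>n. ln (real n))"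
  \<comment> \<open>The excess of the optimal ratio over \<open>\<gamma>\<close>, cut off at 0. It
    is fixed before any precision \<open>\<delta>\<close> is chosen, so one sequence serves them
    all.\<close>
  define \<epsilon> where "\<epsilon> = (\<lambda>n. max 0 (real (best n (D n)) / real (D n) - \<gamma>))"
  have "\<epsilon> \<longlonglongrightarrow> 0"
  proof (rule LIMSEQ_I)
    fix \<delta> :: real assume \<delta>: "0 < \<delta>"
    obtain C where C: "0 < C" "\<And>n \<Delta>. 2 \<le> n \<Longrightarrow> C * ln (real n) \<le> real \<Delta> \<Longrightarrow>
        real (best n \<Delta>) \<le> (\<gamma> + \<delta> / 2) * real \<Delta>"
      using best_asymptotic[of "\<delta> / 2"] \<delta> unfolding \<gamma>_def by auto
    have "eventually (\<lambda>n. norm (real (D n)) \<ge> C * norm (ln (real n))) sequentially"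
      using D C(1) by (rule landau_omega.smallD)
    then have "eventually (\<lambda>n. norm (\<epsilon> n - 0) < \<delta>) sequentially"
      using eventually_ge_at_top[of 2]
    proof eventually_elim
      case (elim n)
      then have n: "2 \<le> n" and "C * ln (real n) \<le> real (D n)" by auto
      \<comment> \<open>Forces \<open>D n > 0\<close>, so that dividing by \<open>D n\<close> is
        meaningful.\<close>
      moreover have "0 < C * ln (real n)" using n C(1) by simp
      ultimately have "real (best n (D n)) / real (D n) \<le> \<gamma> + \<delta> / 2"
        using C(2)[of n "D n"] by (simp add: divide_le_eq)
      then show ?case using \<delta> by (simp add: \<epsilon>_def)
    qed
    then show "\<exists>n0. \<forall>n\<ge>n0. norm (\<epsilon> n - 0) < \<delta>" by (simp add: eventually_sequentially)
  qed
  moreover have "competitive best_algorithm n (D n) (\<gamma> + \<epsilon> n)" for n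
  proof (rule competitive_bestI)
    \<comment> \<open>Covers \<open>D n = 0\<close>, where the quotient in \<open>\<epsilon>\<close>
      is 0 by convention and the claim needs \<open>best n 0 = 0\<close>.\<close>
    have "real (best n (D n)) \<le> 2 * real (D n)" by (intro best_le colorable_greedy) simp
    then show "real (best n (D n)) \<le> (\<gamma> + \<epsilon> n) * real (D n)"
    proof (cases "D n = 0")
      case False
      have "real (best n (D n)) / real (D n) \<le> \<gamma> + \<epsilon> n" by (simp add: \<epsilon>_def)
      then show ?thesis using False by (simp add: divide_le_eq)
    qed simp
  qed
  ultimately show "\<exists>\<epsilon> :: nat \<Rightarrow> real. \<epsilon> \<longlonglongrightarrow> 0 \<and>
      (\<forall>n. competitive best_algorithm n (D n) (exp 1 / (exp 1 - 1) + \<epsilon> n))"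
    unfolding \<gamma>_def by blast
qed

end
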